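(* Let $X$ be a non-reflexive Banach space with an unconditional basis. Then there exists a subspace of $X^*$ which is basic but is not unconditionally basic.
   Context: Let $X$ be a Banach space with a (Schauder) basis (respectively, with an unconditional basis). A subspace $M\subset X^*$ is called basic (respectively, unconditionally basic) if it contains all the biorthogonal functionals $x_i^*$ ($i\in\mathbb{N}$) of some basis (respectively, of some unconditional basis) $(x_i)_{i=1}^\infty$ of $X$. *)

theory Defs
  imports "HOL-Analysis.Analysis"
begin

text \<open>The dual space \<open>X\<^sup>*\<close> of a (real) Banach space \<^typ>\<open>'a::banach\<close> is the type
  \<^typ>\<open>'a \<Rightarrow>\<^sub>L real\<close> with the operator norm.\<close>

definition canonical_embedding ::
    "'a::real_normed_vector \<Rightarrow> (('a \<Rightarrow>\<^sub>L real) \<Rightarrow>\<^sub>L real)" where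
  "canonical_embedding x = Blinfun (\<lambda>f. blinfun_apply f x)"

lemma canonical_embedding_apply [simp]:
  "blinfun_apply (canonical_embedding x) f = blinfun_apply f x"
  unfolding canonical_embedding_def
  by (simp add: bounded_linear_Blinfun_apply
      bounded_bilinear.bounded_linear_left [OF bounded_bilinear_blinfun_apply])

definition reflexive_space :: "'a::real_normed_vector itself \<Rightarrow> bool" where
  "reflexive_space _ \<longleftrightarrow>
     surj (canonical_embedding :: 'a \<Rightarrow> (('a \<Rightarrow>\<^sub>L real) \<Rightarrow>\<^sub>L real))"

definition schauder_basis :: "(nat \<Rightarrow> 'a::real_normed_vector) \<Rightarrow> bool" where
  "schauder_basis x \<longleftrightarrow> (\<forall>y. \<exists>!a :: nat \<Rightarrow> real. (\<lambda>i. a i *\<^sub>R x i) sums y)"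

definition unconditionally_convergent :: "(nat \<Rightarrow> 'a::real_normed_vector) \<Rightarrow> bool" where
  "unconditionally_convergent u \<longleftrightarrow> (\<forall>\<pi>. bij \<pi> \<longrightarrow> summable (\<lambda>i. u (\<pi> i)))"

definition unconditional_basis :: "(nat \<Rightarrow> 'a::real_normed_vector) \<Rightarrow> bool" where
  "unconditional_basis x \<longleftrightarrow> schauder_basis x \<and>
     (\<forall>y a. (\<lambda>i. a i *\<^sub>R x i) sums y \<longrightarrow> unconditionally_convergent (\<lambda>i. a i *\<^sub>R x i))"

text \<open>If \<open>x\<close> is a Schauder basis, its linear span is dense, so the continuous functionals
  \<open>f\<close> below are uniquely determined by \<open>x\<close>; in a Banach space they exist.\<close>

definition biorthogonal_functionals ::
    "(nat \<Rightarrow> 'a::real_normed_vector) \<Rightarrow> (nat \<Rightarrow> 'a \<Rightarrow>\<^sub>L real) \<Rightarrow> bool" where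
  "biorthogonal_functionals x f \<longleftrightarrow>
     (\<forall>i j. blinfun_apply (f i) (x j) = (if i = j then 1 else 0))"

text \<open>The two predicates below are meant for subspaces \<open>M\<close> of \<open>X\<^sup>*\<close>,
  i.e. norm-closed linear subspaces; these conditions are stated separately where they are used.\<close>

definition basic_subspace :: "('a::real_normed_vector \<Rightarrow>\<^sub>L real) set \<Rightarrow> bool" where
  "basic_subspace M \<longleftrightarrow>
     (\<exists>x f. schauder_basis x \<and> biorthogonal_functionals x f \<and> (\<forall>i. f i \<in> M))"

definition unconditionally_basic_subspace ::
    "('a::real_normed_vector \<Rightarrow>\<^sub>L real) set \<Rightarrow> bool" where
  "unconditionally_basic_subspace M \<longleftrightarrow>
     (\<exists>x f. unconditional_basis x \<and> biorthogonal_functionals x f \<and> (\<forall>i. f i \<in> M))"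

end

theory Submission
  imports Defs
begin

text \<open>
  By James, an unconditional basis \<open>e\<close> of a non-reflexive space is not boundedly complete or not
  shrinking. In either case there are bounded blocks \<open>u\<^sub>k\<close> of \<open>e\<close> with bounded functionals \<open>\<phi>\<^sub>k\<close>
  supported on the same blocks, \<open>\<phi>\<^sub>k(u\<^sub>k) = 1\<close>.

  If \<open>e\<close> is not boundedly complete, the partial sums \<open>s\<^sub>n\<close> of the \<open>u\<^sub>k\<close> can be taken bounded, and
  \<open>M = {g. g(s\<^sub>n) \<rightarrow> 0}\<close>. The coordinate functionals of \<open>e\<close> can be moved into \<open>M\<close> by subtracting
  multiples of the \<open>\<phi>\<^sub>k\<close>, which gives a basis resembling the summing basis of \<open>c\<^sub>0\<close>. If \<open>z\<close> were an
  unconditional basis with functionals in \<open>M\<close>, then every \<open>g\<close> would satisfy \<open>g(s\<^sub>n) \<rightarrow> 0\<close>, because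
  the double sum of \<open>g(z\<^sub>i) z\<^sub>i\<^sup>*(u\<^sub>k)\<close> may be evaluated in either order; but \<open>\<phi>\<^sub>0(s\<^sub>n) = 1\<close> eventually.

  If \<open>e\<close> is not shrinking, the \<open>u\<^sub>k\<close> behave like the unit vectors of \<open>\<ell>\<^sub>1\<close>. Index them by the nodes of
  an infinitely branching tree and let \<open>M\<close> consist of the \<open>g\<close> for which \<open>g(u\<^sub>k)\<close> is the limit of \<open>g(u\<^sub>c)\<close>
  over the children \<open>c\<close> of \<open>k\<close>. Replacing \<open>u\<^sub>k\<close> by \<open>u\<^sub>k - u\<^bsub>parent k\<^esub>\<close> yields a basis with functionals
  in \<open>M\<close>. For an unconditional basis \<open>z\<close> with functionals in \<open>M\<close>, every \<open>g\<close> would be the pointwise sum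
  of the functionals \<open>h\<^sub>i = g(z\<^sub>i) z\<^sub>i\<^sup>* \<in> M\<close> with \<open>\<Sum>\<^sub>i |h\<^sub>i(u\<^sub>k)|\<close> bounded. For the \<open>g\<close> with \<open>g(u\<^sub>k) = 1\<close> or \<open>0\<close>
  according to the parity of the depth of \<open>k\<close> this fails: descending the tree, continuity of the
  \<open>h\<^sub>i\<close> forces their partial sums to oscillate once more at each level.
\<close>

section \<open>Norming functionals\<close>

definition sublinear :: "('a::real_vector \<Rightarrow> real) \<Rightarrow> bool" where
  "sublinear p \<longleftrightarrow> (\<forall>x y. p (x + y) \<le> p x + p y) \<and> (\<forall>x t. 0 \<le> t \<longrightarrow> p (t *\<^sub>R x) = t * p x)"

lemma sublinear_add: "sublinear p \<Longrightarrow> p (x + y) \<le> p x + p y"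
  and sublinear_scale: "sublinear p \<Longrightarrow> 0 \<le> t \<Longrightarrow> p (t *\<^sub>R x) = t * p x"
  unfolding sublinear_def by auto

lemma sublinear_minus:
  assumes "sublinear p"
  shows "- p (- x) \<le> p x"
  using sublinear_add[OF assms, of x "- x"] sublinear_scale[OF assms, of 0 0] by simp

lemma sublinear_norm: "sublinear (norm :: 'a::real_normed_vector \<Rightarrow> real)"
  unfolding sublinear_def by (auto simp: norm_triangle_ineq)

text \<open>\<open>shrink p u\<close> is the largest sublinear functional below \<open>p\<close> whose value at \<open>- u\<close> is at most \<open>- p u\<close>.\<close>

definition shrink :: "('a::real_vector \<Rightarrow> real) \<Rightarrow> 'a \<Rightarrow> 'a \<Rightarrow> real" where
  "shrink p u x = (INF t\<in>{0..}. p (x + t *\<^sub>R u) - t * p u)"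

lemma shrink_bdd:
  assumes "sublinear p"
  shows "bdd_below ((\<lambda>t. p (x + t *\<^sub>R u) - t * p u) ` {0..})"
proof (rule bdd_belowI2)
  fix t :: real assume "t \<in> {0..}"
  then have "t * p u = p (t *\<^sub>R u)" by (simp add: sublinear_scale[OF assms])
  also have "\<dots> \<le> p (x + t *\<^sub>R u) + p (- x)"
    using sublinear_add[OF assms, of "x + t *\<^sub>R u" "- x"] by simp
  finally show "- p (- x) \<le> p (x + t *\<^sub>R u) - t * p u" by simp
qed

lemma shrink_le:
  assumes "sublinear p" "0 \<le> t"
  shows "shrink p u x \<le> p (x + t *\<^sub>R u) - t * p u"
  unfolding shrink_def using assms by (intro cINF_lower shrink_bdd) auto

lemma shrink_greatest:
  assumes "\<And>t. 0 \<le> t \<Longrightarrow> b \<le> p (x + t *\<^sub>R u) - t * p u"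
  shows "b \<le> shrink p u x"
  unfolding shrink_def by (rule cINF_greatest) (use assms in auto)

text \<open>Substituting \<open>r * t\<close> for \<open>t\<close> in the infimum gives this half of
  homogeneity; the other half comes from applying it to \<open>inverse r\<close>.\<close>

lemma shrink_scale_le:
  assumes p: "sublinear p" and r: "0 < r"
  shows "shrink p u (r *\<^sub>R x) \<le> r * shrink p u x"
proof -
  have "shrink p u (r *\<^sub>R x) / r \<le> shrink p u x"
  proof (rule shrink_greatest)
    fix t :: real assume t: "0 \<le> t"
    have "shrink p u (r *\<^sub>R x) \<le> p (r *\<^sub>R x + (r * t) *\<^sub>R u) - (r * t) * p u"
      using r t by (intro shrink_le p) auto
    also have "r *\<^sub>R x + (r * t) *\<^sub>R u = r *\<^sub>R (x + t *\<^sub>R u)"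
      by (simp add: algebra_simps)
    also have "p (r *\<^sub>R (x + t *\<^sub>R u)) = r * p (x + t *\<^sub>R u)"
      using r by (intro sublinear_scale p) auto
    finally show "shrink p u (r *\<^sub>R x) / r \<le> p (x + t *\<^sub>R u) - t * p u"
      using r by (simp add: field_simps)
  qed
  then show ?thesis using r by (simp add: field_simps)
qed

lemma sublinear_shrink:
  assumes p: "sublinear p"
  shows "sublinear (shrink p u)"
  unfolding sublinear_def
proof (intro conjI allI impI)
  fix x y
  have "shrink p u (x + y) - shrink p u y \<le> shrink p u x"
  proof (rule shrink_greatest)
    fix t :: real assume t: "0 \<le> t"
    have "shrink p u (x + y) - (p (x + t *\<^sub>R u) - t * p u) \<le> shrink p u y"
    proof (rule shrink_greatest)
      fix s :: real assume s: "0 \<le> s"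
      have "shrink p u (x + y) \<le> p (x + y + (t + s) *\<^sub>R u) - (t + s) * p u"
        using t s by (intro shrink_le p) auto
      also have "x + y + (t + s) *\<^sub>R u = (x + t *\<^sub>R u) + (y + s *\<^sub>R u)"
        by (simp add: algebra_simps)
      also have "p \<dots> \<le> p (x + t *\<^sub>R u) + p (y + s *\<^sub>R u)" by (rule sublinear_add[OF p])
      finally show "shrink p u (x + y) - (p (x + t *\<^sub>R u) - t * p u) \<le> p (y + s *\<^sub>R u) - s * p u"
        by (simp add: algebra_simps)
    qed
    then show "shrink p u (x + y) - shrink p u y \<le> p (x + t *\<^sub>R u) - t * p u" by simp
  qed
  then show "shrink p u (x + y) \<le> shrink p u x + shrink p u y" by simp
next
  fix x and r :: real assume "0 \<le> r"
  show "shrink p u (r *\<^sub>R x) = r * shrink p u x"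
  proof (cases "r = 0")
    case True
    have "shrink p u 0 \<le> 0" using shrink_le[OF p, of 0 u 0] sublinear_scale[OF p, of 0 0] by simp
    moreover have "0 \<le> shrink p u 0"
      by (rule shrink_greatest) (simp add: sublinear_scale[OF p])
    ultimately show ?thesis using True by simp
  next
    case False
    with \<open>0 \<le> r\<close> have r: "0 < r" by simp
    have "shrink p u (inverse r *\<^sub>R r *\<^sub>R x) \<le> inverse r * shrink p u (r *\<^sub>R x)"
      using r by (intro shrink_scale_le p) auto
    then have "r * shrink p u x \<le> shrink p u (r *\<^sub>R x)" using r by (simp add: field_simps)
    then show ?thesis using shrink_scale_le[OF p r, of u x] by simp
  qed
qed

text \<open>Minimality forces \<open>shrink p y = p\<close>, and the term \<open>t = 1\<close> of
  the infimum then reverses subadditivity.\<close>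

lemma minimal_sublinear_additive:
  assumes p: "sublinear p" and min: "\<And>q. sublinear q \<Longrightarrow> (\<And>x. q x \<le> p x) \<Longrightarrow> q = p"
  shows "p (x + y) = p x + p y"
proof -
  have "shrink p y = p"
  proof (rule min)
    show "shrink p y z \<le> p z" for z using shrink_le[OF p, of 0 y z] by simp
  qed (rule sublinear_shrink[OF p])
  then have "p x \<le> p (x + y) - p y" using shrink_le[OF p, of 1 y x] by simp
  then show ?thesis using sublinear_add[OF p, of x y] by simp
qed

text \<open>Zorn's lemma with the order reversed: the pointwise infimum of a nonempty chain is a
  lower bound, finite because every member is at least \<open>- p\<^sub>0 (- x)\<close> at
  \<open>x\<close>.\<close>

lemma ex_minimal_sublinear:
  fixes p\<^sub>0 :: "'a::real_vector \<Rightarrow> real"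
  assumes p0: "sublinear p\<^sub>0"
  obtains p where "sublinear p" "\<And>x. p x \<le> p\<^sub>0 x"
    "\<And>q. sublinear q \<Longrightarrow> (\<And>x. q x \<le> p x) \<Longrightarrow> q = p"
proof -
  define A where "A = {p. sublinear p \<and> p \<le> p\<^sub>0}"
  have "\<exists>m\<in>A. \<forall>a\<in>A. a \<le> m \<longrightarrow> a = m"
  proof (rule predicate_Zorn)
    show "partial_order_on A (relation_of (\<lambda>p q. q \<le> p) A)"
      by (rule partial_order_on_relation_ofI) auto
    fix C assume C: "C \<in> Chains (relation_of (\<lambda>p q. q \<le> p) A)"
    then have CA: "C \<subseteq> A" and lin: "\<And>p q. p \<in> C \<Longrightarrow> q \<in> C \<Longrightarrow> p \<le> q \<or> q \<le> p"
      unfolding Chains_def relation_of_def by auto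
    show "\<exists>u\<in>A. \<forall>a\<in>C. u \<le> a"
    proof (cases "C = {}")
      case True
      then show ?thesis using p0 by (auto simp: A_def)
    next
      case False
      define u where "u x = (INF p\<in>C. p x)" for x
      have bdd: "bdd_below ((\<lambda>p. p x) ` C)" for x
      proof (rule bdd_belowI2)
        fix p assume "p \<in> C"
        then have p: "sublinear p" "p \<le> p\<^sub>0" using CA by (auto simp: A_def)
        show "- p\<^sub>0 (- x) \<le> p x"
          using sublinear_minus[OF p(1), of x] le_funD[OF p(2), of "- x"] by simp
      qed
      have ule: "u x \<le> p x" if "p \<in> C" for p x
        unfolding u_def using that bdd by (intro cINF_lower) auto
      have "sublinear u"
        unfolding sublinear_def
      proof (intro conjI allI impI)
        fix x y
        have "u (x + y) - u y \<le> u x"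
          unfolding u_def[of x]
        proof (rule cINF_greatest[OF False])
          fix p assume p: "p \<in> C"
          have "u (x + y) - p x \<le> u y"
            unfolding u_def[of y]
          proof (rule cINF_greatest[OF False])
            fix q assume q: "q \<in> C"
            \<comment> \<open>Two members of a chain have a common lower bound in it, so a single
              \<open>r\<close> serves both infima.\<close>
            obtain r where r: "r \<in> C" "r \<le> p" "r \<le> q" using lin[OF p q] p q by blast
            have "u (x + y) \<le> r (x + y)" using ule r by blast
            also have "\<dots> \<le> r x + r y" using r CA by (intro sublinear_add) (auto simp: A_def)
            also have "\<dots> \<le> p x + q y" using r by (intro add_mono) (auto simp: le_fun_def)
            finally show "u (x + y) - p x \<le> q y" by simp
          qed
          then show "u (x + y) - u y \<le> p x" by simp
        qed
        then show "u (x + y) \<le> u x + u y" by simp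
      next
        fix x and t :: real assume t: "0 \<le> t"
        have sc: "p (t *\<^sub>R x) = t * p x" if "p \<in> C" for p
          using that CA t by (intro sublinear_scale) (auto simp: A_def)
        show "u (t *\<^sub>R x) = t * u x"
        proof (rule antisym)
          show "t * u x \<le> u (t *\<^sub>R x)"
            unfolding u_def[of "t *\<^sub>R x"]
            by (rule cINF_greatest[OF False]) (simp add: sc mult_left_mono[OF ule t])
          show "u (t *\<^sub>R x) \<le> t * u x"
          proof (cases "t = 0")
            case True
            from False obtain p where "p \<in> C" by blast
            from ule[OF this, of "t *\<^sub>R x"] sc[OF this] show ?thesis using True by simp
          next
            case nz: False
            have "u (t *\<^sub>R x) / t \<le> u x"
              unfolding u_def[of x]
            proof (rule cINF_greatest[OF False])
              fix p assume "p \<in> C"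
              from ule[OF this, of "t *\<^sub>R x"] sc[OF this]
              show "u (t *\<^sub>R x) / t \<le> p x" using t nz by (simp add: field_simps)
            qed
            then show ?thesis using t nz by (simp add: field_simps)
          qed
        qed
      qed
      moreover from False obtain p where "p \<in> C" by blast
      then have "u \<le> p\<^sub>0" using ule[of p] CA
        by (auto simp: A_def le_fun_def intro: order_trans)
      ultimately have "u \<in> A" by (simp add: A_def)
      then show ?thesis using ule by (auto simp: le_fun_def)
    qed
  qed
  then obtain m where m: "m \<in> A" "\<And>a. a \<in> A \<Longrightarrow> a \<le> m \<Longrightarrow> a = m" by blast
  show ?thesis
  proof (rule that[of m])
    show "sublinear m" "\<And>x. m x \<le> p\<^sub>0 x" using m(1) by (auto simp: A_def le_fun_def)
    fix q assume q: "sublinear q" "\<And>x. q x \<le> m x"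
    then have "q \<le> m" by (simp add: le_fun_def)
    moreover from this have "q \<in> A" using q m(1) by (auto simp: A_def)
    ultimately show "q = m" using m(2) by blast
  qed
qed

text \<open>Starting from \<open>shrink norm u\<close> instead of \<open>norm\<close> bounds the
  value at \<open>- u\<close> by \<open>- norm u\<close>, so the minimal functional, which is
  linear, must attain \<open>norm u\<close> at \<open>u\<close>.\<close>

lemma ex_norming_functional:
  fixes u :: "'a::real_normed_vector"
  shows "\<exists>g :: 'a \<Rightarrow>\<^sub>L real. norm g \<le> 1 \<and> blinfun_apply g u = norm u"
proof -
  obtain p where p: "sublinear p" "\<And>x. p x \<le> shrink norm u x"
    and min: "\<And>q. sublinear q \<Longrightarrow> (\<And>x. q x \<le> p x) \<Longrightarrow> q = p"
    using ex_minimal_sublinear[OF sublinear_shrink[OF sublinear_norm]] by metis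
  have add: "p (x + y) = p x + p y" for x y
    by (rule minimal_sublinear_additive[OF p(1) min])
  have p0: "p 0 = 0" using add[of 0 0] by simp
  have minus: "p (- x) = - p x" for x using add[of x "- x"] p0 by simp
  have scale: "p (t *\<^sub>R x) = t * p x" for t x
  proof (cases "0 \<le> t")
    case False
    then have "p ((- t) *\<^sub>R x) = (- t) * p x" by (intro sublinear_scale p(1)) auto
    then show ?thesis by (simp add: minus)
  qed (rule sublinear_scale[OF p(1)])
  have le: "p x \<le> norm x" for x
    using p(2)[of x] shrink_le[OF sublinear_norm, of 0 u x] by simp
  have abs: "\<bar>p x\<bar> \<le> norm x" for x using le[of x] le[of "- x"] by (simp add: minus abs_le_iff)
  have "bounded_linear p"
    by (rule bounded_linear_intro[of p 1]) (simp_all add: add scale abs)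
  then have app: "blinfun_apply (Blinfun p) x = p x" for x by (simp add: bounded_linear_Blinfun_apply)
  have "p (- u) \<le> - norm u"
    using p(2)[of "- u"] shrink_le[OF sublinear_norm, of 1 u "- u"] by simp
  then have "p u = norm u" using le[of u] by (simp add: minus)
  moreover have "norm (Blinfun p) \<le> 1"
    by (rule norm_blinfun_bound) (simp_all add: app abs)
  ultimately show ?thesis using app by metis
qed

section \<open>Unconditional bases\<close>

definition block_index :: "(nat \<Rightarrow> nat) \<Rightarrow> nat \<Rightarrow> nat" where
  "block_index \<nu> i = (LEAST k. i < \<nu> (Suc k))"

lemma block_index_bounds:
  assumes "strict_mono \<nu>" "\<nu> 0 = 0"
  shows "\<nu> (block_index \<nu> i) \<le> i" "i < \<nu> (Suc (block_index \<nu> i))"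
proof -
  have "i < \<nu> (Suc i)" using seq_suble[OF assms(1), of "Suc i"] by simp
  then show "i < \<nu> (Suc (block_index \<nu> i))"
    unfolding block_index_def by (rule LeastI)
  show "\<nu> (block_index \<nu> i) \<le> i"
  proof (cases "block_index \<nu> i")
    case (Suc k)
    then have "\<not> i < \<nu> (Suc k)" unfolding block_index_def by (intro not_less_Least) simp
    with Suc show ?thesis by simp
  qed (simp add: assms)
qed

lemma block_index_eqI:
  assumes "strict_mono \<nu>" "\<nu> k \<le> i" "i < \<nu> (Suc k)"
  shows "block_index \<nu> i = k"
  unfolding block_index_def
proof (rule Least_equality)
  fix l assume "i < \<nu> (Suc l)"
  with assms have "\<nu> k < \<nu> (Suc l)" by simp
  with assms(1) show "k \<le> l" by (simp add: strict_mono_less)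
qed fact

text \<open>A bijection of an initial segment onto \<open>A\<close> is glued to one between the
  complements, so that the permuted order lists \<open>A\<close> first.\<close>

lemma ex_bij_prefix:
  fixes n m :: nat
  assumes A: "A \<subseteq> {n..<m}"
  shows "\<exists>\<sigma>. bij_betw \<sigma> {n..<m} {n..<m} \<and> \<sigma> ` {n..<n + card A} = A"
proof -
  have fin: "finite A" using A finite_subset by blast
  let ?I = "{n..<n + card A}"
  have cA: "card A \<le> m - n" using card_mono[OF _ A] by simp
  then have I: "?I \<subseteq> {n..<m}" by auto
  obtain f where f: "bij_betw f ?I A"
    using finite_same_card_bij[of ?I A] fin by auto
  have "card ({n..<m} - ?I) = card ({n..<m} - A)"
    using I A by (simp add: card_Diff_subset fin)
  then obtain g where g: "bij_betw g ({n..<m} - ?I) ({n..<m} - A)"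
    using finite_same_card_bij[of "{n..<m} - ?I" "{n..<m} - A"] by auto
  define \<sigma> where "\<sigma> i = (if i \<in> ?I then f i else g i)" for i
  have "bij_betw \<sigma> (?I \<union> ({n..<m} - ?I)) (A \<union> ({n..<m} - A))"
    unfolding \<sigma>_def using f g by (intro bij_betw_disjoint_Un) auto
  moreover have "?I \<union> ({n..<m} - ?I) = {n..<m}" "A \<union> ({n..<m} - A) = {n..<m}" using I A by auto
  moreover have "\<sigma> ` ?I = A" using f by (simp add: \<sigma>_def bij_betw_def)
  ultimately show ?thesis by metis
qed

text \<open>Otherwise there are consecutive finite sets \<open>A\<close> with large sums, and a permutation that
  lists each of them contiguously destroys the Cauchy property.\<close>

lemma unconditionally_convergent_tail:
  fixes u :: "nat \<Rightarrow> 'a::banach"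
  assumes u: "unconditionally_convergent u"
  shows "\<exists>N. \<forall>A. finite A \<longrightarrow> A \<subseteq> {N..} \<longrightarrow> norm (sum u A) < 1"
proof (rule ccontr)
  assume "\<not> ?thesis"
  then have "\<forall>N. \<exists>A. finite A \<and> A \<subseteq> {N..} \<and> norm (sum u A) \<ge> 1" by (meson not_less)
  then obtain A where A: "\<And>N. finite (A N)" "\<And>N. A N \<subseteq> {N..}" "\<And>N. norm (sum u (A N)) \<ge> 1"
    by metis
  \<comment> \<open>Each block extends past the largest element of the bad set chosen for its left
    end. Inserting \<open>N\<close> keeps \<open>Max\<close> away from the empty set and the blocks
    nonempty.\<close>
  define \<nu> where "\<nu> k = ((\<lambda>N. Suc (Max (insert N (A N)))) ^^ k) 0" for k
  have \<nu>Suc: "\<nu> (Suc k) = Suc (Max (insert (\<nu> k) (A (\<nu> k))))" for k by (simp add: \<nu>_def)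
  have \<nu>0: "\<nu> 0 = 0" by (simp add: \<nu>_def)
  have mono: "strict_mono \<nu>"
    unfolding strict_mono_Suc_iff \<nu>Suc using A(1) by (simp add: less_Suc_eq_le)
  have sub: "A (\<nu> k) \<subseteq> {\<nu> k..<\<nu> (Suc k)}" for k
  proof
    fix i assume i: "i \<in> A (\<nu> k)"
    then have "i \<le> Max (insert (\<nu> k) (A (\<nu> k)))" using A(1) by (intro Max_ge) auto
    moreover have "\<nu> k \<le> i" using A(2) i by auto
    ultimately show "i \<in> {\<nu> k..<\<nu> (Suc k)}" by (simp add: \<nu>Suc less_Suc_eq_le)
  qed
  obtain \<sigma> where \<sigma>: "\<And>k. bij_betw (\<sigma> k) {\<nu> k..<\<nu> (Suc k)} {\<nu> k..<\<nu> (Suc k)}"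
    "\<And>k. \<sigma> k ` {\<nu> k..<\<nu> k + card (A (\<nu> k))} = A (\<nu> k)"
    using ex_bij_prefix[OF sub] by metis
  define \<pi> where "\<pi> i = \<sigma> (block_index \<nu> i) i" for i
  note bi = block_index_bounds[OF mono \<nu>0]
  have in_block: "\<pi> i \<in> {\<nu> (block_index \<nu> i)..<\<nu> (Suc (block_index \<nu> i))}" for i
    unfolding \<pi>_def using \<sigma>(1)[of "block_index \<nu> i"] bi[of i] by (auto simp: bij_betw_def)
  then have bpi: "block_index \<nu> (\<pi> i) = block_index \<nu> i" for i
    by (intro block_index_eqI mono) auto
  have "bij \<pi>"
  proof (rule bijI)
    show "inj \<pi>"
    proof (rule injI)
      fix i j assume eq: "\<pi> i = \<pi> j"
      then have b: "block_index \<nu> i = block_index \<nu> j" using bpi by metis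
      show "i = j"
        using \<sigma>(1)[of "block_index \<nu> j"] bi[of i] bi[of j] eq
        unfolding \<pi>_def b by (auto simp: bij_betw_def inj_on_def)
    qed
    show "surj \<pi>"
      unfolding surj_def
    proof
      fix m
      let ?k = "block_index \<nu> m"
      have "m \<in> \<sigma> ?k ` {\<nu> ?k..<\<nu> (Suc ?k)}" using \<sigma>(1)[of ?k] bi[of m] by (auto simp: bij_betw_def)
      then obtain i where i: "i \<in> {\<nu> ?k..<\<nu> (Suc ?k)}" "m = \<sigma> ?k i" by blast
      then have "block_index \<nu> i = ?k" by (intro block_index_eqI mono) auto
      with i show "\<exists>i. m = \<pi> i" by (metis \<pi>_def)
    qed
  qed
  with u have "summable (\<lambda>i. u (\<pi> i))" by (simp add: unconditionally_convergent_def)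
  then obtain N where N: "\<And>m n. m \<ge> N \<Longrightarrow> norm (\<Sum>i=m..<n. u (\<pi> i)) < 1"
    unfolding summable_Cauchy by (metis zero_less_one)
  \<comment> \<open>\<open>\<pi>\<close> maps this interval onto \<open>A (\<nu> N)\<close>, so a
    contiguous piece of the rearranged series has norm at least 1.\<close>
  let ?J = "{\<nu> N..<\<nu> N + card (A (\<nu> N))}"
  have "\<nu> N + card (A (\<nu> N)) \<le> \<nu> (Suc N)"
    using card_mono[OF _ sub[of N]] mono
    by (simp add: strict_mono_less_eq le_diff_conv2 ac_simps)
  then have J: "?J \<subseteq> {\<nu> N..<\<nu> (Suc N)}" by auto
  then have piJ: "\<pi> i = \<sigma> N i" if "i \<in> ?J" for i
    unfolding \<pi>_def using that block_index_eqI[OF mono, of N i] by auto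
  have "(\<Sum>i\<in>?J. u (\<pi> i)) = (\<Sum>i\<in>?J. u (\<sigma> N i))" by (simp add: piJ)
  also have "\<dots> = sum u (\<sigma> N ` ?J)"
    using \<sigma>(1)[of N] J by (intro sum.reindex[symmetric, unfolded o_def]) (auto simp: bij_betw_def intro: inj_on_subset)
  finally have "norm (\<Sum>i\<in>?J. u (\<pi> i)) \<ge> 1" using A(3) \<sigma>(2) by simp
  moreover have "\<nu> N \<ge> N" using seq_suble[OF mono] .
  ultimately show False using N[of "\<nu> N"] by (meson not_less)
qed

lemma unconditionally_convergent_bounded:
  fixes u :: "nat \<Rightarrow> 'a::banach"
  assumes "unconditionally_convergent u"
  shows "\<exists>B. \<forall>A. finite A \<longrightarrow> norm (sum u A) \<le> B"
proof -
  obtain N where N: "\<And>A. finite A \<Longrightarrow> A \<subseteq> {N..} \<Longrightarrow> norm (sum u A) < 1"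
    using unconditionally_convergent_tail[OF assms] by blast
  have "norm (sum u A) \<le> (\<Sum>i<N. norm (u i)) + 1" if A: "finite A" for A
  proof -
    have "sum u A = sum u (A \<inter> {..<N}) + sum u (A \<inter> {N..})"
      using A by (subst sum.union_disjoint[symmetric]) (auto intro!: sum.cong)
    also have "norm \<dots> \<le> norm (sum u (A \<inter> {..<N})) + norm (sum u (A \<inter> {N..}))"
      by (rule norm_triangle_ineq)
    also have "norm (sum u (A \<inter> {..<N})) \<le> (\<Sum>i\<in>A \<inter> {..<N}. norm (u i))" by (rule norm_sum)
    also have "\<dots> \<le> (\<Sum>i<N. norm (u i))" by (rule sum_mono2) auto
    also have "norm (sum u (A \<inter> {N..})) \<le> 1" using N[of "A \<inter> {N..}"] A by simp
    finally show ?thesis by simp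
  qed
  then show ?thesis by blast
qed

text \<open>Zabreiko's lemma: by Baire, the closure of some sublevel set of \<open>p\<close> has interior points, and
  successive approximation removes the closure.\<close>

lemma countably_subadditive_bounded:
  fixes p :: "'a::banach \<Rightarrow> real"
  assumes nonneg: "\<And>x. 0 \<le> p x"
    and scale: "\<And>t x. p (t *\<^sub>R x) = \<bar>t\<bar> * p x"
    and subadd: "\<And>y x. y sums x \<Longrightarrow> summable (\<lambda>k. p (y k)) \<Longrightarrow> p x \<le> (\<Sum>k. p (y k))"
  shows "\<exists>C. \<forall>x. p x \<le> C * norm x"
proof -
  have p0: "p 0 = 0" using scale[of 0 0] by simp
  have add: "p (x + y) \<le> p x + p y" for x y
  proof -
    define z where "z k = (if k = 0 then x else if k = 1 then y else 0)" for k :: nat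
    have pz: "p (z k) = (if k = 0 then p x else if k = 1 then p y else 0)" for k
      by (simp add: z_def p0)
    have "z sums (\<Sum>k\<in>{0,1}. z k)" by (rule sums_finite) (auto simp: z_def)
    moreover have "(\<lambda>k. p (z k)) sums (\<Sum>k\<in>{0,1}. p (z k))" by (rule sums_finite) (auto simp: pz)
    ultimately show ?thesis using subadd[of z "x + y"]
      by (simp add: z_def pz sums_iff p0)
  qed
  have diff: "p (x - y) \<le> p x + p y" for x y
    using add[of x "- y"] scale[of "-1" y] by simp
  define S where "S n = closure {x. p x \<le> real n}" for n :: nat
  have "\<exists>n. interior (S n) \<noteq> {}"
  proof (rule ccontr)
    assume "\<not> ?thesis"
    then have emp: "interior (S n) = {}" for n by simp
    have clo: "closed (S n)" for n by (simp add: S_def)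
    have "Met_TC.mtopology interior_of (\<Union>(range S)) = {}"
      by (rule Met_TC.metric_Baire_category_alt)
        (auto simp: mcomplete_iff_complete complete_UNIV emp clo)
    moreover have "\<Union>(range S) = UNIV"
    proof -
      have "x \<in> \<Union>(range S)" for x
        using real_arch_simple[of "p x"] closure_subset by (force simp: S_def)
      then show ?thesis by blast
    qed
    ultimately show False by simp
  qed
  then obtain n x\<^sub>0 r where r: "r > 0" "ball x\<^sub>0 r \<subseteq> S n"
    by (meson ex_in_conv mem_interior)
  \<comment> \<open>Approximating both \<open>x\<^sub>0 + z\<close> and \<open>x\<^sub>0 - z\<close>
    and halving the difference moves the ball to the origin without raising the bound
    \<open>n\<close>.\<close>
  have approx0: "\<exists>y. p y \<le> real n \<and> norm (z - y) \<le> \<epsilon>" if z: "norm z < r" and \<epsilon>: "\<epsilon> > 0" for z \<epsilon>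
  proof -
    have "x\<^sub>0 + z \<in> S n" "x\<^sub>0 - z \<in> S n" using r z by (auto simp: dist_norm subset_iff)
    then obtain y1 y2 where y: "p y1 \<le> n" "dist y1 (x\<^sub>0 + z) < \<epsilon>" "p y2 \<le> n" "dist y2 (x\<^sub>0 - z) < \<epsilon>"
      unfolding S_def closure_approachable using \<epsilon> by blast
    define y where "y = (1/2) *\<^sub>R (y1 - y2)"
    have "p y \<le> n" unfolding y_def scale using diff[of y1 y2] y by simp
    moreover have "z - y = (1/2) *\<^sub>R ((x\<^sub>0 + z - y1) - (x\<^sub>0 - z - y2))"
      unfolding y_def by (simp add: algebra_simps flip: scaleR_2)
    then have "norm (z - y) \<le> (1/2) * (norm (x\<^sub>0 + z - y1) + norm (x\<^sub>0 - z - y2))"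
      using norm_triangle_ineq4[of "x\<^sub>0 + z - y1" "x\<^sub>0 - z - y2"] by simp
    then have "norm (z - y) \<le> \<epsilon>" using y by (simp add: dist_norm norm_minus_commute)
    ultimately show ?thesis by blast
  qed
  \<comment> \<open>For nonzero \<open>z\<close>, scaling by \<open>t = r / (2 * norm z)\<close>
    brings it into the ball; undoing the scaling multiplies \<open>real n\<close> by
    \<open>1 / t\<close>, which gives \<open>C * norm z\<close>.\<close>
  define C where "C = 2 * real n / r"
  have C0: "C \<ge> 0" using r by (simp add: C_def)
  have "\<exists>y. p y \<le> C * norm z \<and> norm (z - y) \<le> \<epsilon>" if \<epsilon>: "\<epsilon> > 0" for z \<epsilon>
  proof (cases "z = 0")
    case True
    then show ?thesis using \<epsilon> by (intro exI[of _ 0]) (simp add: p0)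
  next
    case False
    define t where "t = r / (2 * norm z)"
    have t: "t > 0" using False r by (simp add: t_def)
    have "norm (t *\<^sub>R z) < r" using False r by (simp add: t_def)
    then obtain y where y: "p y \<le> n" "norm (t *\<^sub>R z - y) \<le> t * \<epsilon>"
      using approx0[of "t *\<^sub>R z" "t * \<epsilon>"] t \<epsilon> by auto
    have "p ((1/t) *\<^sub>R y) \<le> C * norm z"
      using y(1) t False r by (simp add: scale C_def t_def field_simps)
    moreover have "z - (1/t) *\<^sub>R y = (1/t) *\<^sub>R (t *\<^sub>R z - y)" using t by (simp add: algebra_simps)
    then have "norm (z - (1/t) *\<^sub>R y) = norm (t *\<^sub>R z - y) / t" using t by (simp only: norm_scaleR) simp
    then have "norm (z - (1/t) *\<^sub>R y) \<le> \<epsilon>" using y(2) t by (simp add: pos_divide_le_eq mult.commute)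
    ultimately show ?thesis by blast
  qed
  then have "\<forall>z \<epsilon>. \<exists>y. \<epsilon> > 0 \<longrightarrow> p y \<le> C * norm z \<and> norm (z - y) \<le> \<epsilon>" by blast
  then obtain Y where Y: "\<And>z \<epsilon>. \<epsilon> > 0 \<Longrightarrow> p (Y z \<epsilon>) \<le> C * norm z"
    "\<And>z \<epsilon>. \<epsilon> > 0 \<Longrightarrow> norm (z - Y z \<epsilon>) \<le> \<epsilon>" by metis
  have "p x \<le> 2 * C * norm x" for x
  proof (cases "x = 0")
    case False
    \<comment> \<open>\<open>z k\<close> is the residual after \<open>k\<close> approximations, at
      most \<open>norm x / 2 ^ k\<close> in norm; summing the geometric series costs the factor
      2.\<close>
    define z where "z = rec_nat x (\<lambda>k z. z - Y z (norm x / 2 ^ Suc k))"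
    define y where "y k = Y (z k) (norm x / 2 ^ Suc k)" for k
    have z0: "z 0 = x" and zS: "z (Suc k) = z k - y k" for k by (simp_all add: z_def y_def)
    have pos: "norm x / 2 ^ Suc k > 0" for k using False by simp
    have nz: "norm (z k) \<le> norm x / 2 ^ k" for k
    proof (cases k)
      case (Suc j)
      then show ?thesis using Y(2)[OF pos, of "z j" j] zS[of j] by (simp add: y_def)
    qed (simp add: z0)
    have py: "p (y k) \<le> C * norm x * (1/2) ^ k" for k
    proof -
      have "p (y k) \<le> C * norm (z k)" unfolding y_def by (rule Y(1)[OF pos])
      also have "\<dots> \<le> C * (norm x / 2 ^ k)" using nz C0 by (intro mult_left_mono)
      finally show ?thesis by (simp add: power_divide)
    qed
    have geo: "(\<lambda>k. C * norm x * (1/2) ^ k) sums (C * norm x * 2)"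
      using sums_mult[OF geometric_sums[of "1/2::real"]] by simp
    have sm: "summable (\<lambda>k. p (y k))"
      by (rule summable_comparison_test'[OF sums_summable[OF geo]]) (simp add: py nonneg)
    have part: "(\<Sum>k<m. y k) = x - z m" for m by (induction m) (simp_all add: z0 zS)
    have "z \<longlonglongrightarrow> 0"
    proof (rule Lim_null_comparison)
      show "\<forall>\<^sub>F k in sequentially. norm (z k) \<le> norm x * (1/2) ^ k"
        using nz by (simp add: power_divide)
      show "(\<lambda>k. norm x * (1/2) ^ k) \<longlonglongrightarrow> 0"
        by (intro tendsto_mult_right_zero LIMSEQ_realpow_zero) auto
    qed
    then have "y sums x" unfolding sums_def part using tendsto_diff[OF tendsto_const] by fastforce
    then have "p x \<le> (\<Sum>k. p (y k))" using sm by (rule subadd)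
    also have "\<dots> \<le> C * norm x * 2"
      using suminf_le[OF py sm sums_summable[OF geo]] geo by (simp add: sums_iff)
    finally show ?thesis by simp
  qed (simp add: p0)
  then show ?thesis by blast
qed

section \<open>Continuity of the coordinates of an unconditional basis\<close>

lemma schauder_basis_unique:
  assumes "schauder_basis e" "(\<lambda>i. a i *\<^sub>R e i) sums y" "(\<lambda>i. b i *\<^sub>R e i) sums y"
  shows "a = b"
  using assms unfolding schauder_basis_def by blast

lemma schauder_basis_nonzero:
  assumes "schauder_basis e"
  shows "e i \<noteq> 0"
proof
  assume "e i = 0"
  then have "(\<lambda>j. (if j = i then 1 else 0) *\<^sub>R e j) = (\<lambda>j. 0)" by auto
  then have "(\<lambda>j. (if j = i then 1 else 0::real) *\<^sub>R e j) sums 0" by (metis sums_zero)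
  moreover have "(\<lambda>j. 0 *\<^sub>R e j) sums 0" by simp
  ultimately have "(\<lambda>j. if j = i then 1 else 0::real) = (\<lambda>j. 0)"
    by (rule schauder_basis_unique[OF assms])
  then show False by (metis zero_neq_one)
qed

text \<open>\<open>countably_subadditive_bounded\<close> is applied to the supremum of the norms of
  all finite partial sums, which is finite by unconditional convergence. Continuity of the
  coefficients is not yet available, so the work lies in showing that they may be summed
  termwise.\<close>

lemma unconditional_basis_bounded:
  fixes e :: "nat \<Rightarrow> 'a::banach"
  assumes e: "unconditional_basis e"
  shows "\<exists>K. \<forall>y a A. (\<lambda>i. a i *\<^sub>R e i) sums y \<longrightarrow> finite A \<longrightarrow> norm (\<Sum>i\<in>A. a i *\<^sub>R e i) \<le> K * norm y"
proof -
  have sch: "schauder_basis e" using e by (simp add: unconditional_basis_def)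
  obtain c where c: "\<And>y. (\<lambda>i. c y i *\<^sub>R e i) sums y"
    using sch unfolding schauder_basis_def by metis
  have cI: "c y = a" if "(\<lambda>i. a i *\<^sub>R e i) sums y" for y a
    by (rule schauder_basis_unique[OF sch c that])
  define P where "P A y = (\<Sum>i\<in>A. c y i *\<^sub>R e i)" for A y
  define p where "p y = (SUP A\<in>{A. finite A}. norm (P A y))" for y
  have bdd: "bdd_above ((\<lambda>A. norm (P A y)) ` {A. finite A})" for y
  proof -
    have "unconditionally_convergent (\<lambda>i. c y i *\<^sub>R e i)"
      using e c unfolding unconditional_basis_def by blast
    from unconditionally_convergent_bounded[OF this]
    obtain B where "\<And>A. finite A \<Longrightarrow> norm (P A y) \<le> B" unfolding P_def by blast
    then show ?thesis by (intro bdd_aboveI2[of _ _ B]) simp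
  qed
  have le: "norm (P A y) \<le> p y" if "finite A" for A y
    unfolding p_def using that bdd by (intro cSUP_upper) auto
  have least: "p y \<le> b" if "\<And>A. finite A \<Longrightarrow> norm (P A y) \<le> b" for y b
    unfolding p_def by (rule cSUP_least) (use that in auto)
  have Plim: "(\<lambda>n. P {..<n} y) \<longlonglongrightarrow> y" for y using c[of y] by (simp add: P_def sums_def)
  have "\<exists>C. \<forall>y. p y \<le> C * norm y"
  proof (rule countably_subadditive_bounded)
    show "0 \<le> p y" for y using le[of "{}" y] by (simp add: P_def)
    show "p (t *\<^sub>R y) = \<bar>t\<bar> * p y" for t y
    proof -
      have "(\<lambda>i. (t * c y i) *\<^sub>R e i) sums (t *\<^sub>R y)"
        using sums_scaleR_right[OF c[of y], of t] by simp
      then have "c (t *\<^sub>R y) = (\<lambda>i. t * c y i)" by (rule cI)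
      then have P: "P A (t *\<^sub>R y) = t *\<^sub>R P A y" for A by (simp add: P_def scaleR_sum_right)
      have 1: "p (t *\<^sub>R y) \<le> \<bar>t\<bar> * p y"
        by (rule least) (simp add: P le mult_left_mono)
      show ?thesis
      proof (cases "t = 0")
        case False
        have "p y \<le> p (t *\<^sub>R y) / \<bar>t\<bar>"
          using False le[of _ "t *\<^sub>R y"] by (intro least) (simp add: P field_simps)
        with 1 False show ?thesis by (simp add: field_simps)
      next
        case True
        have "p (t *\<^sub>R y) \<ge> 0" using le[of "{}" "t *\<^sub>R y"] by (simp add: P_def)
        with True 1 show ?thesis by simp
      qed
    qed
    show "p x \<le> (\<Sum>k. p (y k))" if y: "y sums x" and sm: "summable (\<lambda>k. p (y k))" for y x
    proof -
      have ny: "norm (y k) \<le> p (y k)" for k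
        by (rule LIMSEQ_le_const2[OF tendsto_norm[OF Plim[of "y k"]]]) (auto intro: le)
      have "summable (\<lambda>k. c (y k) i)" for i
      proof (rule summable_comparison_test')
        show "summable (\<lambda>k. p (y k) / norm (e i))" by (rule summable_divide[OF sm])
        show "norm (c (y k) i) \<le> p (y k) / norm (e i)" for k
          using le[of "{i}" "y k"] schauder_basis_nonzero[OF sch, of i]
          by (simp add: P_def pos_le_divide_eq)
      qed
      then have "(\<lambda>k. c (y k) i) sums (\<Sum>k. c (y k) i)" for i by (rule summable_sums)
      moreover define b where "b i = (\<Sum>k. c (y k) i)" for i
      ultimately have b: "(\<lambda>k. c (y k) i) sums b i" for i by simp
      have Psums: "(\<lambda>k. P A (y k)) sums (\<Sum>i\<in>A. b i *\<^sub>R e i)" for A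
        unfolding P_def by (intro sums_sum sums_scaleR_left b)
      have bound: "norm (\<Sum>i\<in>A. b i *\<^sub>R e i) \<le> (\<Sum>k. p (y k))" if "finite A" for A
      proof -
        have "summable (\<lambda>k. norm (P A (y k)))"
          by (rule summable_comparison_test'[OF sm]) (simp add: le that)
        then have "norm (\<Sum>k. P A (y k)) \<le> (\<Sum>k. norm (P A (y k)))" by (rule summable_norm)
        also have "\<dots> \<le> (\<Sum>k. p (y k))"
          by (rule suminf_le) (use le that sm \<open>summable (\<lambda>k. norm (P A (y k)))\<close> in auto)
        finally show ?thesis using Psums[of A] by (simp add: sums_iff)
      qed
      \<comment> \<open>\<open>d k n\<close> tends to 0 in \<open>n\<close> and is dominated by
        \<open>2 * p (y k)\<close>, so Tannery's theorem carries the limit through the sum over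
        \<open>k\<close>.\<close>
      define d where "d k n = norm (P {..<n} (y k) - y k)" for k n
      have d: "norm (d k n) \<le> 2 * p (y k)" for k n
        using norm_triangle_ineq4[of "P {..<n} (y k)" "y k"] le[of "{..<n}" "y k"] ny[of k]
        by (simp add: d_def)
      have sd: "summable (\<lambda>k. d k n)" for n
        by (rule summable_comparison_test'[OF summable_mult[OF sm, of 2]]) (rule d)
      have "(\<lambda>n. \<Sum>k. d k n) \<longlonglongrightarrow> (\<Sum>k. 0::real)"
      proof (rule tannerys_theorem[THEN conjunct2, THEN conjunct2])
        show "(\<lambda>n. d k n) \<longlonglongrightarrow> 0" for k
          unfolding d_def using Plim[of "y k"] by (simp add: LIM_zero tendsto_norm_zero)
        show "\<forall>\<^sub>F (k, n) in sequentially \<times>\<^sub>F sequentially. norm (d k n) \<le> 2 * p (y k)"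
          using d by (simp add: case_prod_unfold)
        show "summable (\<lambda>k. 2 * p (y k))" by (rule summable_mult[OF sm])
      qed simp
      then have dlim: "(\<lambda>n. \<Sum>k. d k n) \<longlonglongrightarrow> 0" by simp
      have "(\<lambda>n. (\<Sum>i<n. b i *\<^sub>R e i) - x) \<longlonglongrightarrow> 0"
      proof (rule Lim_null_comparison[OF always_eventually dlim], rule allI)
        fix n
        have "(\<lambda>k. P {..<n} (y k) - y k) sums ((\<Sum>i<n. b i *\<^sub>R e i) - x)"
          by (intro sums_diff Psums y)
        then have "norm ((\<Sum>i<n. b i *\<^sub>R e i) - x) = norm (\<Sum>k. P {..<n} (y k) - y k)"
          by (simp add: sums_iff)
        also have "\<dots> \<le> (\<Sum>k. d k n)"
          unfolding d_def by (rule summable_norm) (rule sd[unfolded d_def])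
        finally show "norm ((\<Sum>i<n. b i *\<^sub>R e i) - x) \<le> (\<Sum>k. d k n)" .
      qed
      then have "(\<lambda>i. b i *\<^sub>R e i) sums x" unfolding sums_def by (rule LIM_zero_cancel)
      then have "c x = b" by (rule cI)
      then show ?thesis by (intro least) (simp add: P_def bound)
    qed
  qed
  then obtain K where K: "\<And>y. p y \<le> K * norm y" by blast
  have "norm (\<Sum>i\<in>A. a i *\<^sub>R e i) \<le> K * norm y"
    if "(\<lambda>i. a i *\<^sub>R e i) sums y" "finite A" for y a A
  proof -
    have "c y = a" by (rule cI) (rule that)
    then show ?thesis using order_trans[OF le[OF that(2)] K, of y] by (simp add: P_def)
  qed
  then show ?thesis by blast
qed

text \<open>One-element sets in \<open>unconditional_basis_bounded\<close> bound each coefficient,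
  since \<open>norm (e i)\<close> is nonzero.\<close>

lemma ex_biorthogonal_functionals:
  fixes e :: "nat \<Rightarrow> 'a::banach"
  assumes e: "unconditional_basis e"
  shows "\<exists>es. biorthogonal_functionals e es"
proof -
  have sch: "schauder_basis e" using e by (simp add: unconditional_basis_def)
  obtain c where c: "\<And>y. (\<lambda>i. c y i *\<^sub>R e i) sums y"
    using sch unfolding schauder_basis_def by metis
  have cI: "c y = a" if "(\<lambda>i. a i *\<^sub>R e i) sums y" for y a
    by (rule schauder_basis_unique[OF sch c that])
  obtain K where K: "\<And>y a A. (\<lambda>i. a i *\<^sub>R e i) sums y \<Longrightarrow> finite A
      \<Longrightarrow> norm (\<Sum>i\<in>A. a i *\<^sub>R e i) \<le> K * norm y"
    using unconditional_basis_bounded[OF e] by blast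
  have "bounded_linear (\<lambda>y. c y i)" for i
  proof (rule bounded_linear_intro)
    fix x y and t :: real
    have "(\<lambda>i. (c x i + c y i) *\<^sub>R e i) sums (x + y)"
      using sums_add[OF c[of x] c[of y]] by (simp add: scaleR_add_left)
    then show "c (x + y) i = c x i + c y i" by (simp add: cI)
    have "(\<lambda>i. (t * c x i) *\<^sub>R e i) sums (t *\<^sub>R x)"
      using sums_scaleR_right[OF c[of x], of t] by simp
    then show "c (t *\<^sub>R x) i = t *\<^sub>R c x i" by (simp add: cI)
    show "norm (c x i) \<le> norm x * (K / norm (e i))"
      using K[OF c[of x], of "{i}"] schauder_basis_nonzero[OF sch, of i] by (simp add: field_simps)
  qed
  then have app: "blinfun_apply (Blinfun (\<lambda>y. c y i)) y = c y i" for i y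
    by (simp add: bounded_linear_Blinfun_apply)
  have "c (e j) i = (if i = j then 1 else 0)" for i j
  proof -
    have "(\<lambda>i. (if i = j then 1 else 0::real) *\<^sub>R e i) sums (\<Sum>i\<in>{j}. (if i = j then 1 else 0::real) *\<^sub>R e i)"
      by (rule sums_finite) auto
    then have "(\<lambda>i. (if i = j then 1 else 0::real) *\<^sub>R e i) sums e j" by simp
    then show ?thesis by (simp add: cI)
  qed
  then show ?thesis
    unfolding biorthogonal_functionals_def using app by (intro exI[of _ "\<lambda>i. Blinfun (\<lambda>y. c y i)"]) simp
qed

lemma biorthogonal_sums:
  assumes es: "biorthogonal_functionals e es" and y: "(\<lambda>i. a i *\<^sub>R e i) sums y"
  shows "blinfun_apply (es j) y = a j"
proof -
  have "(\<lambda>i. blinfun_apply (es j) (a i *\<^sub>R e i)) sums blinfun_apply (es j) y"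
    by (rule bounded_linear.sums[OF blinfun.bounded_linear_right y])
  moreover have "(\<lambda>i. blinfun_apply (es j) (a i *\<^sub>R e i)) = (\<lambda>i. if i = j then a i else 0)"
    using es by (auto simp: biorthogonal_functionals_def blinfun.scaleR_right)
  ultimately have "(\<lambda>i. if i = j then a i else 0) sums blinfun_apply (es j) y" by (simp only:)
  then show ?thesis using sums_single[of j a] by (rule sums_unique2)
qed

section \<open>Perturbing an unconditional basis along blocks\<close>

lemma schauder_basisI:
  assumes f: "biorthogonal_functionals x f"
    and sums: "\<And>y. (\<lambda>i. blinfun_apply (f i) y *\<^sub>R x i) sums y"
  shows "schauder_basis x"
  unfolding schauder_basis_def
proof (intro allI ex1I)
  show "(\<lambda>i. blinfun_apply (f i) y *\<^sub>R x i) sums y" for y by (rule sums)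
  show "a = (\<lambda>i. blinfun_apply (f i) y)" if "(\<lambda>i. a i *\<^sub>R x i) sums y" for a y
    using biorthogonal_sums[OF f that] by auto
qed

text \<open>The series is weakly unconditionally Cauchy: it converges absolutely at each point with
  a uniform bound, so the pointwise sum of every subseries is continuous.\<close>

lemma wuc_functional:
  fixes \<phi> :: "nat \<Rightarrow> 'a::real_normed_vector \<Rightarrow>\<^sub>L real"
  assumes bound: "\<And>n y. (\<Sum>k<n. \<bar>blinfun_apply (\<phi> k) y\<bar>) \<le> C * norm y"
  shows "\<exists>g. \<forall>y. (\<lambda>k. if k \<in> A then blinfun_apply (\<phi> k) y else 0) sums blinfun_apply g y"
proof -
  define t where "t y k = (if k \<in> A then blinfun_apply (\<phi> k) y else 0)" for y k
  have le: "(\<Sum>k<n. \<bar>t y k\<bar>) \<le> C * norm y" for n y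
    by (rule order_trans[OF sum_mono bound]) (simp add: t_def)
  have abs: "summable (\<lambda>k. \<bar>t y k\<bar>)" for y
    by (rule bounded_imp_summable[of _ "C * norm y"]) (use le[of y "Suc _"] in \<open>simp_all add: lessThan_Suc_atMost\<close>)
  then have t: "t y sums suminf (t y)" for y
    by (intro summable_sums) (rule summable_rabs_cancel)
  have "bounded_linear (\<lambda>y. suminf (t y))"
  proof (rule bounded_linear_intro)
    fix x y and r :: real
    have "t (x + y) = (\<lambda>k. t x k + t y k)" by (auto simp: t_def blinfun.add_right)
    then show "suminf (t (x + y)) = suminf (t x) + suminf (t y)"
      using sums_add[OF t[of x] t[of y]] by (simp add: sums_iff)
    have "t (r *\<^sub>R x) = (\<lambda>k. r * t x k)" by (auto simp: t_def blinfun.scaleR_right)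
    then show "suminf (t (r *\<^sub>R x)) = r *\<^sub>R suminf (t x)"
      using sums_mult[OF t[of x], of r] by (simp add: sums_iff)
    have "\<bar>suminf (t x)\<bar> \<le> (\<Sum>k. \<bar>t x k\<bar>)" by (rule summable_rabs[OF abs])
    also have "\<dots> \<le> C * norm x" by (rule suminf_le_const[OF abs le])
    finally show "norm (suminf (t x)) \<le> norm x * C" by (simp add: mult.commute)
  qed
  then have "blinfun_apply (Blinfun (\<lambda>y. suminf (t y))) y = suminf (t y)" for y
    by (simp add: bounded_linear_Blinfun_apply)
  then have "\<forall>y. t y sums blinfun_apply (Blinfun (\<lambda>y. suminf (t y))) y" using t by simp
  then show ?thesis unfolding t_def by blast
qed

text \<open>\<open>K\<close> bounds all finite coordinate projections at once. The locale is
  interpreted for the given basis and again for the hypothetical unconditional basis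
  \<open>z\<close>.\<close>

locale unconditional_system =
  fixes e :: "nat \<Rightarrow> 'a::banach" and es :: "nat \<Rightarrow> 'a \<Rightarrow>\<^sub>L real" and K :: real
  assumes coord: "blinfun_apply (es i) (e j) = (if i = j then 1 else 0)"
    and expansion: "(\<lambda>i. blinfun_apply (es i) y *\<^sub>R e i) sums y"
    and unconditional_bound: "finite A \<Longrightarrow> norm (\<Sum>i\<in>A. blinfun_apply (es i) y *\<^sub>R e i) \<le> K * norm y"
begin

definition proj :: "nat set \<Rightarrow> 'a \<Rightarrow> 'a" where
  "proj A y = (\<Sum>i\<in>A. blinfun_apply (es i) y *\<^sub>R e i)"

lemma norm_proj: "finite A \<Longrightarrow> norm (proj A y) \<le> K * norm y"
  unfolding proj_def by (rule unconditional_bound)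

lemma K_ge_1: "1 \<le> K"
proof -
  have "e 0 \<noteq> 0" using coord[of 0 0] by auto
  moreover have "norm (e 0) \<le> K * norm (e 0)" using norm_proj[of "{0}" "e 0"] by (simp add: proj_def coord)
  ultimately show ?thesis by simp
qed

lemma proj_tendsto: "(\<lambda>n. proj {..<n} y) \<longlonglongrightarrow> y"
  using expansion[of y] by (simp add: proj_def sums_def)

lemma apply_proj: "blinfun_apply g (proj A y) = (\<Sum>i\<in>A. blinfun_apply g (e i) * blinfun_apply (es i) y)"
  by (simp add: proj_def blinfun.sum_right blinfun.scaleR_right mult.commute)

lemma coord_proj: "finite A \<Longrightarrow> blinfun_apply (es i) (proj A y) = (if i \<in> A then blinfun_apply (es i) y else 0)"
proof -
  assume A: "finite A"
  have "blinfun_apply (es i) (proj A y) = (\<Sum>j\<in>A. if j = i then blinfun_apply (es j) y else 0)"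
    unfolding apply_proj by (rule sum.cong) (auto simp: coord)
  then show ?thesis using A by simp
qed

lemma proj_proj: "finite A \<Longrightarrow> finite B \<Longrightarrow> proj B (proj A y) = proj (A \<inter> B) y"
  unfolding proj_def[of B] proj_def[of "A \<inter> B"]
  by (subst Int_commute) (auto simp: coord_proj sum.If_cases if_distrib[of "\<lambda>t. t *\<^sub>R _"] cong: if_cong intro!: sum.mono_neutral_cong_right)

lemma proj_union: "finite A \<Longrightarrow> finite B \<Longrightarrow> A \<inter> B = {} \<Longrightarrow> proj (A \<union> B) y = proj A y + proj B y"
  unfolding proj_def by (rule sum.union_disjoint)

text \<open>The terms of one sign add up to \<open>g\<close> of a single projection; the two signs
  account for the factor 2.\<close>

lemma sum_abs_le:
  assumes A: "finite A"
  shows "(\<Sum>i\<in>A. \<bar>blinfun_apply g (e i) * blinfun_apply (es i) y\<bar>) \<le> 2 * K * norm g * norm y"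
proof -
  let ?t = "\<lambda>i. blinfun_apply g (e i) * blinfun_apply (es i) y"
  have le: "\<bar>\<Sum>i\<in>B. ?t i\<bar> \<le> K * norm g * norm y" if "finite B" for B
  proof -
    have "\<bar>\<Sum>i\<in>B. ?t i\<bar> = norm (blinfun_apply g (proj B y))" by (simp add: apply_proj)
    also have "\<dots> \<le> norm g * norm (proj B y)" by (rule norm_blinfun)
    also have "\<dots> \<le> norm g * (K * norm y)" using norm_proj[OF that] by (rule mult_left_mono) simp
    finally show ?thesis by (simp add: ac_simps)
  qed
  let ?P = "{i\<in>A. ?t i \<ge> 0}" and ?N = "{i\<in>A. \<not> ?t i \<ge> 0}"
  have "(\<Sum>i\<in>A. \<bar>?t i\<bar>) = (\<Sum>i\<in>?P. ?t i) + (\<Sum>i\<in>?N. - ?t i)"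
  proof -
    have "(\<Sum>i\<in>A. \<bar>?t i\<bar>) = (\<Sum>i\<in>?P. \<bar>?t i\<bar>) + (\<Sum>i\<in>?N. \<bar>?t i\<bar>)"
      using A by (subst sum.union_disjoint[symmetric]) (auto intro!: sum.cong)
    also have "(\<Sum>i\<in>?P. \<bar>?t i\<bar>) = (\<Sum>i\<in>?P. ?t i)" by (rule sum.cong) auto
    also have "(\<Sum>i\<in>?N. \<bar>?t i\<bar>) = (\<Sum>i\<in>?N. - ?t i)" by (rule sum.cong) auto
    finally show ?thesis .
  qed
  also have "\<dots> \<le> K * norm g * norm y + K * norm g * norm y"
    using le[of ?P] le[of ?N] A by (intro add_mono) (auto simp: sum_negf)
  finally show ?thesis by (simp add: ac_simps)
qed

lemma functional_sums: "(\<lambda>i. blinfun_apply g (e i) * blinfun_apply (es i) y) sums blinfun_apply g y"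
  using bounded_linear.sums[OF blinfun.bounded_linear_right expansion[of y], of g]
  by (simp add: blinfun.scaleR_right mult.commute)

end

lemma unconditional_basis_system:
  fixes e :: "nat \<Rightarrow> 'a::banach"
  assumes e: "unconditional_basis e" and es: "biorthogonal_functionals e es"
  shows "\<exists>K. unconditional_system e es K"
proof -
  obtain K where K: "\<And>y a A. (\<lambda>i. a i *\<^sub>R e i) sums y \<Longrightarrow> finite A
      \<Longrightarrow> norm (\<Sum>i\<in>A. a i *\<^sub>R e i) \<le> K * norm y"
    using unconditional_basis_bounded[OF e] by blast
  have "(\<lambda>i. blinfun_apply (es i) y *\<^sub>R e i) sums y" for y
  proof -
    obtain a where a: "(\<lambda>i. a i *\<^sub>R e i) sums y"
      using e unfolding unconditional_basis_def schauder_basis_def by meson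
    then have "a = (\<lambda>i. blinfun_apply (es i) y)" using biorthogonal_sums[OF es a] by auto
    with a show ?thesis by simp
  qed
  with K es show ?thesis
    unfolding unconditional_system_def biorthogonal_functionals_def by metis
qed

text \<open>\<open>\<gamma> k\<close> is only required to be bounded and normalised at
  \<open>u k\<close>; its truncation \<open>\<phi> k\<close> to the block provides the
  locality.\<close>

locale block_system = unconditional_system +
  fixes \<nu> :: "nat \<Rightarrow> nat" and u :: "nat \<Rightarrow> 'a" and \<gamma> :: "nat \<Rightarrow> 'a \<Rightarrow>\<^sub>L real" and C D :: real
  assumes \<nu>_mono: "strict_mono \<nu>" and \<nu>_0: "\<nu> 0 = 0"
    and u_block: "proj {\<nu> k..<\<nu> (Suc k)} (u k) = u k"
    and \<gamma>_u: "blinfun_apply (\<gamma> k) (u k) = 1"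
    and norm_\<gamma>: "norm (\<gamma> k) \<le> C" and norm_u: "norm (u k) \<le> D"
begin

abbreviation I :: "nat \<Rightarrow> nat set" where "I k \<equiv> {\<nu> k..<\<nu> (Suc k)}"
abbreviation b :: "nat \<Rightarrow> nat" where "b \<equiv> block_index \<nu>"

definition \<phi> :: "nat \<Rightarrow> 'a \<Rightarrow>\<^sub>L real" where
  "\<phi> k = (\<Sum>i\<in>I k. blinfun_apply (\<gamma> k) (e i) *\<^sub>R es i)"

lemma in_block_iff: "i \<in> I k \<longleftrightarrow> b i = k"
  using block_index_bounds[OF \<nu>_mono \<nu>_0, of i] block_index_eqI[OF \<nu>_mono, of k i] by auto

lemma \<phi>_apply: "blinfun_apply (\<phi> k) y = blinfun_apply (\<gamma> k) (proj (I k) y)"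
  by (simp add: \<phi>_def apply_proj blinfun.sum_left blinfun.scaleR_left)

lemma C_nonneg: "0 \<le> C" using norm_\<gamma>[of 0] norm_ge_zero order_trans by blast

lemma D_nonneg: "0 \<le> D" using norm_u[of 0] norm_ge_zero order_trans by blast

lemma abs_\<phi>_le_proj: "\<bar>blinfun_apply (\<phi> k) y\<bar> \<le> C * norm (proj (I k) y)"
proof -
  have "\<bar>blinfun_apply (\<phi> k) y\<bar> \<le> norm (\<gamma> k) * norm (proj (I k) y)"
    unfolding \<phi>_apply using norm_blinfun[of "\<gamma> k" "proj (I k) y"] by simp
  also have "\<dots> \<le> C * norm (proj (I k) y)" by (rule mult_right_mono[OF norm_\<gamma>]) simp
  finally show ?thesis .
qed

lemma abs_\<phi>_le: "\<bar>blinfun_apply (\<phi> k) y\<bar> \<le> C * K * norm y"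
  using order_trans[OF abs_\<phi>_le_proj mult_left_mono[OF norm_proj C_nonneg]] by (simp add: ac_simps)

lemma coord_u: "blinfun_apply (es j) (u k) = (if b j = k then blinfun_apply (es j) (u k) else 0)"
  by (subst u_block[symmetric], subst coord_proj) (auto simp: in_block_iff[symmetric])

lemma \<phi>_e: "blinfun_apply (\<phi> k) (e i) = (if b i = k then blinfun_apply (\<phi> k) (e i) else 0)"
proof (cases "b i = k")
  case False
  then have "i \<notin> I k" using in_block_iff by blast
  then have "proj (I k) (e i) = 0" unfolding proj_def by (intro sum.neutral) (auto simp: coord)
  then show ?thesis by (simp add: \<phi>_apply blinfun.zero_right)
qed simp

lemma blocks_disjoint: "k \<noteq> l \<Longrightarrow> I k \<inter> I l = {}"
  by (auto simp only: set_eq_iff Int_iff in_block_iff empty_iff)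

lemma \<phi>_u: "blinfun_apply (\<phi> k) (u l) = (if k = l then 1 else 0)"
proof -
  have "proj (I k) (u l) = proj (I l \<inter> I k) (u l)"
    by (subst u_block[symmetric], subst proj_proj) auto
  then show ?thesis using u_block[of l] blocks_disjoint[of l k]
    by (auto simp: \<phi>_apply \<gamma>_u proj_def blinfun.zero_right)
qed

lemma b_at_top: "filterlim b sequentially sequentially"
  unfolding filterlim_at_top eventually_sequentially
proof (intro allI exI impI)
  fix Z n assume "\<nu> Z \<le> n"
  then have "\<nu> Z < \<nu> (Suc (b n))"
    using block_index_bounds(2)[OF \<nu>_mono \<nu>_0, of n] by simp
  then show "Z \<le> b n" using \<nu>_mono by (simp add: strict_mono_less)
qed

lemma \<nu>_at_top: "filterlim \<nu> sequentially sequentially"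
  using \<nu>_mono by (rule filterlim_subseq)

lemma lessThan_\<nu>_Suc: "{..<\<nu> (Suc k)} = {..<\<nu> k} \<union> I k"
proof -
  have "\<nu> k \<le> \<nu> (Suc k)" using \<nu>_mono by (simp add: strict_mono_less_eq)
  then show ?thesis by auto
qed

text \<open>\<open>\<phi> k\<close> sees only the part of \<open>y\<close> in block
  \<open>k\<close>, a difference of two partial sums of a convergent expansion.\<close>

lemma \<phi>_tendsto: "(\<lambda>k. blinfun_apply (\<phi> k) y) \<longlonglongrightarrow> 0"
proof (rule Lim_null_comparison)
  show "\<forall>\<^sub>F k in sequentially. norm (blinfun_apply (\<phi> k) y) \<le> C * norm (proj {..<\<nu> (Suc k)} y - proj {..<\<nu> k} y)"
  proof (rule always_eventually, rule allI)
    fix k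
    have "proj {..<\<nu> (Suc k)} y = proj {..<\<nu> k} y + proj (I k) y"
      unfolding lessThan_\<nu>_Suc by (rule proj_union) auto
    then show "norm (blinfun_apply (\<phi> k) y) \<le> C * norm (proj {..<\<nu> (Suc k)} y - proj {..<\<nu> k} y)"
      using abs_\<phi>_le_proj[of k y] by simp
  qed
  have 1: "(\<lambda>k. proj {..<\<nu> k} y) \<longlonglongrightarrow> y"
    by (rule filterlim_compose[OF proj_tendsto \<nu>_at_top])
  have "(\<lambda>k. proj {..<\<nu> (Suc k)} y - proj {..<\<nu> k} y) \<longlonglongrightarrow> y - y"
    by (intro tendsto_diff 1 filterlim_compose[OF 1 filterlim_Suc])
  then show "(\<lambda>k. C * norm (proj {..<\<nu> (Suc k)} y - proj {..<\<nu> k} y)) \<longlonglongrightarrow> 0"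
    by (intro tendsto_mult_right_zero tendsto_norm_zero) simp
qed

text \<open>The summand in \<open>full_blocks\<close> is the difference between the expansions of \<open>y\<close> with respect to
  \<open>x\<close> and \<open>e\<close>, summed over the block \<open>I l\<close>.\<close>

lemma block_perturbation_basis:
  fixes w :: "nat \<Rightarrow> 'a" and \<psi> :: "nat \<Rightarrow> 'a \<Rightarrow>\<^sub>L real"
  defines "x \<equiv> \<lambda>i. e i + blinfun_apply (\<phi> (b i)) (e i) *\<^sub>R w (b i)"
    and "xs \<equiv> \<lambda>j. es j + blinfun_apply (es j) (u (b j)) *\<^sub>R \<psi> (b j)"
  assumes biorth: "biorthogonal_functionals x xs"
    and norm_w: "\<And>k. norm (w k) \<le> B"
    and \<psi>_tendsto: "\<And>y. (\<lambda>l. blinfun_apply (\<psi> l) y) \<longlonglongrightarrow> 0"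
    and full_blocks: "\<And>y. (\<lambda>n. \<Sum>l<n. blinfun_apply (\<psi> l) y *\<^sub>R u l
        + (blinfun_apply (\<phi> l) y + blinfun_apply (\<psi> l) y) *\<^sub>R w l) \<longlonglongrightarrow> 0"
  shows "schauder_basis x"
proof (rule schauder_basisI[OF biorth])
  fix y
  define t where "t l = blinfun_apply (\<psi> l) y *\<^sub>R u l
        + (blinfun_apply (\<phi> l) y + blinfun_apply (\<psi> l) y) *\<^sub>R w l" for l
  \<comment> \<open>Stated for subsets of a block, so that it covers full blocks as well as the
    truncated one at the end of a partial sum.\<close>
  have block: "(\<Sum>j\<in>J. blinfun_apply (xs j) y *\<^sub>R x j) = proj J y + (blinfun_apply (\<psi> l) y *\<^sub>R proj J (u l)
      + (blinfun_apply (\<phi> l) (proj J y) + blinfun_apply (\<psi> l) y * blinfun_apply (\<phi> l) (proj J (u l))) *\<^sub>R w l)"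
    if J: "J \<subseteq> I l" for J l
  proof -
    have bj: "b j = l" if "j \<in> J" for j using that J in_block_iff by blast
    have "(\<Sum>j\<in>J. blinfun_apply (xs j) y *\<^sub>R x j) =
      (\<Sum>j\<in>J. (blinfun_apply (es j) y + blinfun_apply (\<psi> l) y * blinfun_apply (es j) (u l)) *\<^sub>R e j
        + (blinfun_apply (\<phi> l) (e j) * blinfun_apply (es j) y
           + blinfun_apply (\<psi> l) y * (blinfun_apply (\<phi> l) (e j) * blinfun_apply (es j) (u l))) *\<^sub>R w l)"
      by (rule sum.cong) (simp_all add: x_def xs_def bj blinfun.add_left blinfun.scaleR_left algebra_simps)
    also have "\<dots> = proj J y + (blinfun_apply (\<psi> l) y *\<^sub>R proj J (u l)
      + (blinfun_apply (\<phi> l) (proj J y) + blinfun_apply (\<psi> l) y * blinfun_apply (\<phi> l) (proj J (u l))) *\<^sub>R w l)"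
      unfolding apply_proj
      by (simp add: proj_def sum.distrib scaleR_add_left scaleR_sum_left scaleR_sum_right sum_distrib_left algebra_simps)
    finally show ?thesis .
  qed
  \<comment> \<open>On a full block the projection reproduces \<open>u l\<close>, where
    \<open>\<phi> l\<close> is 1, so the correction is exactly \<open>t l\<close>.\<close>
  have full: "(\<Sum>j<\<nu> l. blinfun_apply (xs j) y *\<^sub>R x j) = proj {..<\<nu> l} y + (\<Sum>k<l. t k)" for l
  proof (induction l)
    case 0
    then show ?case by (simp add: \<nu>_0 proj_def)
  next
    case (Suc l)
    have un: "{..<\<nu> (Suc l)} = {..<\<nu> l} \<union> I l" "{..<\<nu> l} \<inter> I l = {}"
      by (rule lessThan_\<nu>_Suc) auto
    have "blinfun_apply (\<phi> l) (proj (I l) y) = blinfun_apply (\<phi> l) y"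
      by (simp add: \<phi>_apply proj_proj)
    then have "(\<Sum>j\<in>I l. blinfun_apply (xs j) y *\<^sub>R x j) = proj (I l) y + t l"
      using block[of "I l" l] by (simp add: u_block \<phi>_u t_def)
    then show ?case unfolding un(1)
      using Suc.IH un(2) by (subst sum.union_disjoint, simp, simp, simp, subst proj_union) (simp_all add: algebra_simps)
  qed
  define J where "J n = {\<nu> (b n)..<n}" for n
  have finJ: "finite (J n)" for n by (simp add: J_def)
  have JI: "J n \<subseteq> I (b n)" for n
    unfolding J_def using block_index_bounds(2)[OF \<nu>_mono \<nu>_0, of n] by auto
  have un: "{..<n} = {..<\<nu> (b n)} \<union> J n" "{..<\<nu> (b n)} \<inter> J n = {}" for n
    unfolding J_def using block_index_bounds(1)[OF \<nu>_mono \<nu>_0, of n] by auto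
  \<comment> \<open>The correction from the unfinished block: it is small because
    \<open>\<psi>\<close> and the part of \<open>y\<close> in \<open>J n\<close> tend to 0 while
    \<open>u\<close> and \<open>w\<close> stay bounded.\<close>
  define r where "r n = blinfun_apply (\<psi> (b n)) y *\<^sub>R proj (J n) (u (b n))
      + (blinfun_apply (\<phi> (b n)) (proj (J n) y)
      + blinfun_apply (\<psi> (b n)) y * blinfun_apply (\<phi> (b n)) (proj (J n) (u (b n)))) *\<^sub>R w (b n)" for n
  have pJ: "proj {..<n} y = proj {..<\<nu> (b n)} y + proj (J n) y" for n
    by (subst un(1)) (rule proj_union[OF finite_lessThan finJ un(2)])
  have part: "(\<Sum>j<n. blinfun_apply (xs j) y *\<^sub>R x j) = proj {..<n} y + (\<Sum>k<b n. t k) + r n" for n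
  proof -
    have "(\<Sum>j<n. blinfun_apply (xs j) y *\<^sub>R x j)
      = (\<Sum>j<\<nu> (b n). blinfun_apply (xs j) y *\<^sub>R x j) + (\<Sum>j\<in>J n. blinfun_apply (xs j) y *\<^sub>R x j)"
      by (subst un(1)) (rule sum.union_disjoint[OF finite_lessThan finJ un(2)])
    then show ?thesis unfolding full block[OF JI] r_def pJ[of n] by (simp add: algebra_simps)
  qed
  have "r \<longlonglongrightarrow> 0"
  proof (rule Lim_null_comparison[OF always_eventually], rule allI)
    fix n
    let ?\<psi> = "blinfun_apply (\<psi> (b n)) y" and ?pu = "proj (J n) (u (b n))" and ?py = "proj (J n) y"
    have K0: "0 \<le> K" using K_ge_1 by simp
    have B0: "0 \<le> B" using norm_w[of 0] norm_ge_zero order_trans by blast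
    have pu: "norm ?pu \<le> K * D"
      using order_trans[OF norm_proj[OF finJ] mult_left_mono[OF norm_u K0]] .
    have "\<bar>blinfun_apply (\<phi> (b n)) ?pu\<bar> \<le> C * K * (K * D)"
      using order_trans[OF abs_\<phi>_le mult_left_mono[OF pu]] C_nonneg K0 by simp
    then have 1: "\<bar>?\<psi> * blinfun_apply (\<phi> (b n)) ?pu\<bar> \<le> \<bar>?\<psi>\<bar> * (C * K * (K * D))"
      unfolding abs_mult by (rule mult_left_mono) simp
    have 2: "\<bar>blinfun_apply (\<phi> (b n)) ?py\<bar> \<le> C * K * norm ?py" by (rule abs_\<phi>_le)
    have "norm (r n) \<le> norm (?\<psi> *\<^sub>R ?pu) + norm ((blinfun_apply (\<phi> (b n)) ?py
        + ?\<psi> * blinfun_apply (\<phi> (b n)) ?pu) *\<^sub>R w (b n))"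
      unfolding r_def by (rule norm_triangle_ineq)
    also have "\<dots> \<le> \<bar>?\<psi>\<bar> * (K * D) + (C * K * norm ?py + \<bar>?\<psi>\<bar> * (C * K * (K * D))) * B"
      unfolding norm_scaleR
    proof (intro add_mono mult_mono)
      show "\<bar>blinfun_apply (\<phi> (b n)) ?py + ?\<psi> * blinfun_apply (\<phi> (b n)) ?pu\<bar>
         \<le> C * K * norm ?py + \<bar>?\<psi>\<bar> * (C * K * (K * D))"
        using 1 2 by linarith
    qed (use pu norm_w K0 C_nonneg D_nonneg in auto)
    finally show "norm (r n) \<le> \<bar>?\<psi>\<bar> * (K * D) + (C * K * norm (proj {..<n} y - proj {..<\<nu> (b n)} y)
        + \<bar>?\<psi>\<bar> * (C * K * (K * D))) * B"
      using pJ[of n] by simp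
  next
    have \<psi>0: "(\<lambda>n. \<bar>blinfun_apply (\<psi> (b n)) y\<bar>) \<longlonglongrightarrow> 0"
      using filterlim_compose[OF \<psi>_tendsto b_at_top] by (rule tendsto_rabs_zero)
    have "(\<lambda>n. proj {..<n} y - proj {..<\<nu> (b n)} y) \<longlonglongrightarrow> y - y"
      by (intro tendsto_diff proj_tendsto
        filterlim_compose[OF proj_tendsto filterlim_compose[OF \<nu>_at_top b_at_top]])
    then have p0: "(\<lambda>n. norm (proj {..<n} y - proj {..<\<nu> (b n)} y)) \<longlonglongrightarrow> 0"
      by (intro tendsto_norm_zero) simp
    show "(\<lambda>n. \<bar>blinfun_apply (\<psi> (b n)) y\<bar> * (K * D) + (C * K * norm (proj {..<n} y - proj {..<\<nu> (b n)} y)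
        + \<bar>blinfun_apply (\<psi> (b n)) y\<bar> * (C * K * (K * D))) * B) \<longlonglongrightarrow> 0"
      by (intro tendsto_add_zero tendsto_mult_left_zero tendsto_mult_right_zero \<psi>0 p0)
  qed
  moreover have "(\<lambda>n. \<Sum>k<b n. t k) \<longlonglongrightarrow> 0"
    unfolding t_def by (rule filterlim_compose[OF full_blocks b_at_top])
  ultimately have "(\<lambda>n. proj {..<n} y + (\<Sum>k<b n. t k) + r n) \<longlonglongrightarrow> y + 0 + 0"
    by (intro tendsto_add proj_tendsto)
  then show "(\<lambda>j. blinfun_apply (xs j) y *\<^sub>R x j) sums y"
    unfolding sums_def part by simp
qed

end

section \<open>Bases that are not boundedly complete\<close>

text \<open>Each induction step adds a rectangle far out. The rows below \<open>n'\<close> sum to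
  nearly \<open>r\<close>, of which the columns below \<open>m\<close>, and the rows below
  \<open>n\<close> past \<open>m\<close>, contribute almost nothing; the cross rectangles with
  \<open>A\<close> and \<open>B\<close> are small as well.\<close>

lemma double_sum_limit_aux:
  fixes c :: "nat \<Rightarrow> nat \<Rightarrow> real"
  assumes col: "\<And>i. (\<lambda>k. c k i) sums 0" and row: "\<And>k. (\<lambda>i. c k i) sums R k"
    and R: "R sums r" and r: "r > 0"
  shows "\<exists>A B. finite A \<and> finite B \<and> (\<Sum>k\<in>A. \<Sum>i\<in>B. c k i) \<ge> real N * (r / 2)"
proof (induction N)
  case 0
  then show ?case by (intro exI[of _ "{}"]) simp
next
  case (Suc N)
  then obtain A B where fin: "finite A" "finite B" and AB: "(\<Sum>k\<in>A. \<Sum>i\<in>B. c k i) \<ge> real N * (r / 2)"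
    by blast
  define S where "S A B = (\<Sum>k\<in>A. \<Sum>i\<in>B. c k i)" for A B
  \<comment> \<open>Nine errors are incurred, five in the new rectangle and two in each cross
    rectangle, which leaves \<open>r / 2\<close>.\<close>
  define \<epsilon> where "\<epsilon> = r / 18"
  have \<epsilon>: "\<epsilon> > 0" using r by (simp add: \<epsilon>_def)
  have colS: "(\<lambda>n. S {..<n} B) \<longlonglongrightarrow> 0" for B
  proof -
    have "(\<lambda>n. \<Sum>i\<in>B. \<Sum>k<n. c k i) \<longlonglongrightarrow> (\<Sum>i\<in>B. 0)"
      using col by (intro tendsto_sum) (simp add: sums_def)
    then show ?thesis unfolding S_def by (subst sum.swap) simp
  qed
  have rowS: "(\<lambda>m. S A {..<m}) \<longlonglongrightarrow> sum R A" for A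
    unfolding S_def using row by (intro tendsto_sum) (simp add: sums_def)
  have RS: "(\<lambda>n. sum R {..<n}) \<longlonglongrightarrow> r" using R by (simp add: sums_def)
  have close: "\<exists>p\<ge>q. \<forall>n\<ge>p. \<bar>X n - l\<bar> < \<epsilon>" if "X \<longlonglongrightarrow> l" for X :: "nat \<Rightarrow> real" and l q
    using LIMSEQ_D[OF that \<epsilon>] by (metis le_trans nat_le_linear real_norm_def)
  obtain n0 where n0: "A \<subseteq> {..<n0}" using finite_nat_iff_bounded fin by blast
  obtain m0 where m0: "B \<subseteq> {..<m0}" using finite_nat_iff_bounded fin by blast
  obtain n where n: "n \<ge> n0" "\<And>n'. n' \<ge> n \<Longrightarrow> \<bar>S {..<n'} B - 0\<bar> < \<epsilon>" using close[OF colS] by blast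
  obtain m1 where m1: "m1 \<ge> m0" "\<And>m'. m' \<ge> m1 \<Longrightarrow> \<bar>S A {..<m'} - sum R A\<bar> < \<epsilon>"
    using close[OF rowS] by blast
  obtain m where m: "m \<ge> m1" "\<And>m'. m' \<ge> m \<Longrightarrow> \<bar>S {..<n} {..<m'} - sum R {..<n}\<bar> < \<epsilon>"
    using close[OF rowS] by blast
  obtain p where p: "p \<ge> n" "\<And>n'. n' \<ge> p \<Longrightarrow> \<bar>S {..<n'} {..<m} - 0\<bar> < \<epsilon>" using close[OF colS] by blast
  obtain n' where n': "n' \<ge> p" "\<And>k. k \<ge> n' \<Longrightarrow> \<bar>sum R {..<k} - r\<bar> < \<epsilon>" using close[OF RS] by blast
  obtain m' where m': "m' \<ge> m" "\<And>k. k \<ge> m' \<Longrightarrow> \<bar>S {..<n'} {..<k} - sum R {..<n'}\<bar> < \<epsilon>"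
    using close[OF rowS] by blast
  have unL: "S (A1 \<union> A2) B = S A1 B + S A2 B" if "finite A1" "finite A2" "A1 \<inter> A2 = {}" for A1 A2 B
    unfolding S_def using that by (rule sum.union_disjoint)
  have unR: "S A (B1 \<union> B2) = S A B1 + S A B2" if "finite B1" "finite B2" "B1 \<inter> B2 = {}" for A B1 B2
    unfolding S_def using that by (simp add: sum.union_disjoint sum.distrib)
  have nn': "{..<n'} = {..<n} \<union> {n..<n'}" and mm': "{..<m'} = {..<m} \<union> {m..<m'}"
    using n' p m' by auto
  have L: "S {..<n'} B = S {..<n} B + S {n..<n'} B" for B by (subst nn', rule unL) auto
  have Rt: "S A {..<m'} = S A {..<m} + S A {m..<m'}" for A by (subst mm', rule unR) auto
  have dA: "A \<inter> {n..<n'} = {}" and dB: "B \<inter> {m..<m'} = {}" using n0 n m0 m1 m by auto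
  have "S (A \<union> {n..<n'}) (B \<union> {m..<m'}) = S A B + S A {m..<m'} + (S {n..<n'} B + S {n..<n'} {m..<m'})"
    using fin dA dB by (simp add: unL unR)
  moreover have "\<bar>S A {m..<m'}\<bar> \<le> 2 * \<epsilon>"
    using Rt[of A] m1(2)[of m] m1(2)[of m'] m m' by simp
  moreover have "\<bar>S {n..<n'} B\<bar> \<le> 2 * \<epsilon>"
    using L[of B] n(2)[of n] n(2)[of n'] p n' by simp
  moreover have "S {n..<n'} {m..<m'} \<ge> r - 5 * \<epsilon>"
    using L[of "{..<m'}"] L[of "{..<m}"] Rt[of "{n..<n'}"] m(2)[of m] m(2)[of m'] p(2)[of n']
      n'(2)[of n'] m'(2)[of m'] m'(1) n'(1) by simp
  ultimately have "S (A \<union> {n..<n'}) (B \<union> {m..<m'}) \<ge> S A B + r / 2"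
    by (simp add: \<epsilon>_def)
  with AB have "S (A \<union> {n..<n'}) (B \<union> {m..<m'}) \<ge> real (Suc N) * (r / 2)"
    by (simp add: S_def field_simps)
  then show ?case using fin unfolding S_def by (intro exI[of _ "A \<union> {n..<n'}"] exI[of _ "B \<union> {m..<m'}"]) auto
qed

text \<open>The iterated sums of a bounded bilinear form on \<open>c\<^sub>0 \<times> c\<^sub>0\<close> agree; this is a gliding hump argument.\<close>

lemma double_sum_limit:
  fixes c :: "nat \<Rightarrow> nat \<Rightarrow> real"
  assumes bound: "\<And>A B. finite A \<Longrightarrow> finite B \<Longrightarrow> \<bar>\<Sum>k\<in>A. \<Sum>i\<in>B. c k i\<bar> \<le> C"
    and col: "\<And>i. (\<lambda>k. c k i) sums 0" and row: "\<And>k. (\<lambda>i. c k i) sums R k" and R: "R sums r"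
  shows "r = 0"
proof -
  \<comment> \<open>Stated for an arbitrary matrix so that it also applies to
    \<open>- c\<close>.\<close>
  have "\<not> r > 0" if bound: "\<And>A B. finite A \<Longrightarrow> finite B \<Longrightarrow> \<bar>\<Sum>k\<in>A. \<Sum>i\<in>B. c k i\<bar> \<le> C"
    and col: "\<And>i. (\<lambda>k. c k i) sums 0" and row: "\<And>k. (\<lambda>i. c k i) sums R k" and R: "R sums r"
  for c :: "nat \<Rightarrow> nat \<Rightarrow> real" and R r
  proof
    assume r: "r > 0"
    obtain N :: nat where N: "C < real N * (r / 2)" using ex_less_of_nat_mult[of "r / 2" C] r by auto
    obtain A B where "finite A" "finite B" "(\<Sum>k\<in>A. \<Sum>i\<in>B. c k i) \<ge> real N * (r / 2)"
      using double_sum_limit_aux[OF col row R r] by blast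
    with bound[of A B] N show False by simp
  qed
  note pos = this
  have "\<not> r > 0" by (rule pos[OF assms])
  moreover have "\<not> - r > 0"
  proof (rule pos)
    show "\<bar>\<Sum>k\<in>A. \<Sum>i\<in>B. - c k i\<bar> \<le> C" if "finite A" "finite B" for A B
      using bound[OF that] by (simp add: sum_negf)
    show "(\<lambda>k. - c k i) sums 0" for i using sums_minus[OF col[of i]] by simp
    show "(\<lambda>i. - c k i) sums - R k" for k by (rule sums_minus[OF row])
    show "(\<lambda>k. - R k) sums - r" by (rule sums_minus[OF R])
  qed
  ultimately show ?thesis by simp
qed

text \<open>The subspaces of both cases have this form; boundedness of the family \<open>y\<close>
  makes the condition survive norm limits.\<close>

lemma closed_subspace_null_functionals:
  fixes y :: "'k \<Rightarrow> nat \<Rightarrow> 'a::real_normed_vector"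
  assumes y: "\<And>k n. norm (y k n) \<le> B"
  defines "M \<equiv> {g :: 'a \<Rightarrow>\<^sub>L real. \<forall>k. (\<lambda>n. blinfun_apply g (y k n)) \<longlonglongrightarrow> 0}"
  shows "subspace M" "closed M"
proof -
  show "subspace M"
    unfolding subspace_def M_def
    by (auto simp: blinfun.add_left blinfun.scaleR_left blinfun.zero_left intro: tendsto_add_zero tendsto_mult_right_zero)
  show "closed M"
    unfolding closed_sequential_limits
  proof (intro allI impI)
    fix G :: "nat \<Rightarrow> 'a \<Rightarrow>\<^sub>L real" and g assume G: "(\<forall>n. G n \<in> M) \<and> G \<longlonglongrightarrow> g"
    have "(\<lambda>n. blinfun_apply g (y k n)) \<longlonglongrightarrow> 0" for k
    proof (rule LIMSEQ_I)
      fix \<epsilon> :: real assume \<epsilon>: "0 < \<epsilon>"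
      have B: "0 \<le> B" using y[of undefined 0] norm_ge_zero order_trans by blast
      have "\<epsilon> / (2 * (B + 1)) > 0" using \<epsilon> B by simp
      from LIMSEQ_D[OF conjunct2[OF G] this] obtain m where m: "norm (G m - g) < \<epsilon> / (2 * (B + 1))"
        by blast
      have small: "\<bar>blinfun_apply g x - blinfun_apply (G m) x\<bar> \<le> \<epsilon> / 2" if "norm x \<le> B" for x
      proof -
        have "\<bar>blinfun_apply g x - blinfun_apply (G m) x\<bar> = norm (blinfun_apply (G m - g) x)"
          by (simp add: blinfun.diff_left)
        also have "\<dots> \<le> norm (G m - g) * norm x" by (rule norm_blinfun)
        also have "\<dots> \<le> \<epsilon> / (2 * (B + 1)) * (B + 1)"
          using m that B \<epsilon> by (intro mult_mono) auto
        also have "\<dots> = \<epsilon> / 2" using B by (simp add: field_simps)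
        finally show ?thesis .
      qed
      have "(\<lambda>n. blinfun_apply (G m) (y k n)) \<longlonglongrightarrow> 0" using G by (simp add: M_def)
      from LIMSEQ_D[OF this half_gt_zero[OF \<epsilon>]]
      obtain N where N: "\<And>n. n \<ge> N \<Longrightarrow> \<bar>blinfun_apply (G m) (y k n)\<bar> < \<epsilon> / 2" by auto
      have "norm (blinfun_apply g (y k n) - 0) < \<epsilon>" if "n \<ge> N" for n
        using N[OF that] small[OF y, of k n] unfolding real_norm_def diff_zero by linarith
      then show "\<exists>N. \<forall>n\<ge>N. norm (blinfun_apply g (y k n) - 0) < \<epsilon>" by blast
    qed
    then show "g \<in> M" by (simp add: M_def)
  qed
qed

lemma ex_block_sequence:
  fixes P :: "nat \<Rightarrow> nat \<Rightarrow> bool"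
  assumes "\<And>n. \<exists>m>n. P n m"
  shows "\<exists>\<nu>. strict_mono \<nu> \<and> \<nu> 0 = 0 \<and> (\<forall>k. P (\<nu> k) (\<nu> (Suc k)))"
proof -
  obtain m where m: "\<And>n. m n > n" "\<And>n. P n (m n)" using assms by metis
  show ?thesis
    by (rule exI[of _ "\<lambda>k. (m ^^ k) 0"]) (simp add: strict_mono_Suc_iff m)
qed

section \<open>Functionals tending to 0 along bounded divergent partial sums\<close>

context unconditional_system
begin

text \<open>Sending \<open>e i\<close> to \<open>x i\<close> turns \<open>u k\<close> into
  \<open>u k + s (\<nu> k) = s (\<nu> (Suc k))\<close>, as for a summing basis. Dually,
  \<open>xs j\<close> subtracts the multiple of \<open>\<phi> (Suc (b j))\<close> that cancels the
  eventual value of \<open>es j\<close> on \<open>s n\<close>.\<close>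

lemma not_boundedly_complete_case:
  assumes bounded: "\<And>n. norm (\<Sum>i<n. a i *\<^sub>R e i) \<le> L"
    and div: "\<not> summable (\<lambda>i. a i *\<^sub>R e i)"
  shows "\<exists>M. subspace M \<and> closed M \<and> basic_subspace M \<and> \<not> unconditionally_basic_subspace (M :: ('a \<Rightarrow>\<^sub>L real) set)"
proof -
  define s where "s n = (\<Sum>i<n. a i *\<^sub>R e i)" for n
  have norm_s: "norm (s n) \<le> L" for n unfolding s_def by (rule bounded)
  have s_diff: "n \<le> m \<Longrightarrow> (\<Sum>i=n..<m. a i *\<^sub>R e i) = s m - s n" for n m
    by (simp add: s_def sum_diff_nat_ivl lessThan_atLeast0)
  have coord_s: "blinfun_apply (es j) (s n) = (if j < n then a j else 0)" for j n
    by (simp add: s_def blinfun.sum_right blinfun.scaleR_right coord if_distrib[of "\<lambda>t. _ * t"] cong: if_cong)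
  obtain \<delta> where \<delta>: "\<delta> > 0" "\<And>N. \<exists>m\<ge>N. \<exists>n. norm (\<Sum>i=m..<n. a i *\<^sub>R e i) \<ge> \<delta>"
    using div unfolding summable_Cauchy by (meson not_less)
  \<comment> \<open>Two partial sums beyond \<open>N\<close> differ by at least
    \<open>\<delta>\<close>, so one of them is at distance at least \<open>\<delta> / 2\<close> from
    \<open>s N\<close>.\<close>
  have "\<exists>m>N. norm (s m - s N) \<ge> \<delta> / 2" for N
  proof -
    obtain m n where mn: "m \<ge> N" "norm (\<Sum>i=m..<n. a i *\<^sub>R e i) \<ge> \<delta>" using \<delta> by blast
    then have "m < n" using \<delta>(1) by (cases "m < n") auto
    then have "\<delta> \<le> norm (s n - s m)" using mn(2) s_diff[of m n] by simp
    also have "\<dots> \<le> norm (s n - s N) + norm (s m - s N)"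
      using norm_triangle_ineq4[of "s n - s N" "s m - s N"] by simp
    finally have "norm (s n - s N) \<ge> \<delta> / 2 \<or> norm (s m - s N) \<ge> \<delta> / 2" by linarith
    moreover have "n > N" using mn \<open>m < n\<close> by simp
    moreover have "m > N \<or> norm (s m - s N) = 0" using mn by (cases "m = N") auto
    ultimately show ?thesis using \<delta>(1) by force
  qed
  then obtain \<nu> where \<nu>: "strict_mono \<nu>" "\<nu> 0 = 0" "\<And>k. norm (s (\<nu> (Suc k)) - s (\<nu> k)) \<ge> \<delta> / 2"
    using ex_block_sequence[of "\<lambda>n m. norm (s m - s n) \<ge> \<delta> / 2"] by blast
  define u where "u k = s (\<nu> (Suc k)) - s (\<nu> k)" for k
  have nu: "norm (u k) \<ge> \<delta> / 2" for k using \<nu>(3) by (simp add: u_def)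
  have "\<exists>g :: 'a \<Rightarrow>\<^sub>L real. norm g \<le> 1 / (\<delta> / 2) \<and> blinfun_apply g (u k) = 1" for k
  proof -
    obtain g where g: "norm g \<le> 1" "blinfun_apply g (u k) = norm (u k)"
      using ex_norming_functional[of "u k"] by blast
    have pos: "norm (u k) > 0" using nu[of k] \<delta> by linarith
    have "norm ((1 / norm (u k)) *\<^sub>R g) = norm g / norm (u k)" by simp
    also have "\<dots> \<le> 1 / (\<delta> / 2)" by (rule frac_le) (use g(1) nu[of k] \<delta>(1) in auto)
    finally have "norm ((1 / norm (u k)) *\<^sub>R g) \<le> 1 / (\<delta> / 2)" .
    moreover have "blinfun_apply ((1 / norm (u k)) *\<^sub>R g) (u k) = 1"
      using g(2) pos by (simp add: blinfun.scaleR_left)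
    ultimately show ?thesis by blast
  qed
  then obtain \<gamma> :: "nat \<Rightarrow> 'a \<Rightarrow>\<^sub>L real" where \<gamma>: "\<And>k. norm (\<gamma> k) \<le> 1 / (\<delta> / 2)" "\<And>k. blinfun_apply (\<gamma> k) (u k) = 1" by metis
  have u_sum: "u k = (\<Sum>i=\<nu> k..<\<nu> (Suc k). a i *\<^sub>R e i)" for k
    unfolding u_def using \<nu>(1) by (intro s_diff[symmetric]) (simp add: strict_mono_less_eq)
  have coord_u': "blinfun_apply (es j) (u k) = (if j \<in> {\<nu> k..<\<nu> (Suc k)} then a j else 0)" for j k
    by (simp add: u_sum blinfun.sum_right blinfun.scaleR_right coord if_distrib[of "\<lambda>t. _ * t"] cong: if_cong)
  interpret block_system e es K \<nu> u \<gamma> "1 / (\<delta> / 2)" "2 * L"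
  proof unfold_locales
    show "proj {\<nu> k..<\<nu> (Suc k)} (u k) = u k" for k
      unfolding proj_def by (subst u_sum) (simp add: coord_u')
    show "norm (u k) \<le> 2 * L" for k
      using norm_triangle_ineq4[of "s (\<nu> (Suc k))" "s (\<nu> k)"] norm_s[of "\<nu> (Suc k)"] norm_s[of "\<nu> k"]
      by (simp add: u_def)
  qed (use \<nu> \<gamma> in auto)
  have proj_s: "proj (I m) (s n) = (if \<nu> (Suc m) \<le> n then u m else 0)" if "\<nu> (Suc m) \<le> n \<or> n \<le> \<nu> m" for m n
    unfolding proj_def u_sum coord_s using that
    by (auto intro!: sum.cong sum.neutral)
  \<comment> \<open>Indices \<open>n\<close> strictly inside block \<open>m\<close> are excluded:
    there \<open>s n\<close> contains only a part of \<open>u m\<close>, on which the value of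
    \<open>\<phi> m\<close> is not known.\<close>
  have \<phi>_s: "blinfun_apply (\<phi> m) (s n) = (if \<nu> (Suc m) \<le> n then 1 else 0)" if "\<nu> (Suc m) \<le> n \<or> n \<le> \<nu> m" for m n
    using proj_s[OF that] by (simp add: \<phi>_apply \<gamma> blinfun.zero_right)
  have \<phi>_w: "blinfun_apply (\<phi> m) (s (\<nu> k)) = (if m < k then 1 else 0)" for m k
  proof -
    have "\<nu> (Suc m) \<le> \<nu> k \<longleftrightarrow> m < k" "\<nu> k \<le> \<nu> m \<longleftrightarrow> k \<le> m"
      using \<nu>(1) by (auto simp: strict_mono_less_eq)
    then show ?thesis using \<phi>_s[of m "\<nu> k"] by auto
  qed
  define \<psi> where "\<psi> l = - \<phi> (Suc l)" for l
  define x where "x = (\<lambda>i. e i + blinfun_apply (\<phi> (b i)) (e i) *\<^sub>R s (\<nu> (b i)))"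
  define xs where "xs = (\<lambda>j. es j + blinfun_apply (es j) (u (b j)) *\<^sub>R \<psi> (b j))"
  have es_u: "blinfun_apply (es j) (u (b j)) = a j" for j
    using in_block_iff[of j "b j"] by (simp add: coord_u')
  have biorth: "biorthogonal_functionals x xs"
    unfolding biorthogonal_functionals_def
  proof (intro allI)
    fix j i
    have "j < \<nu> (b i) \<longleftrightarrow> b j < b i"
    proof
      assume "j < \<nu> (b i)"
      then have "\<nu> (b j) < \<nu> (b i)" using block_index_bounds(1)[OF \<nu>(1,2), of j] by simp
      then show "b j < b i" using \<nu>(1) by (simp add: strict_mono_less)
    next
      assume "b j < b i"
      then have "\<nu> (Suc (b j)) \<le> \<nu> (b i)" using \<nu>(1) by (simp add: strict_mono_less_eq)
      then show "j < \<nu> (b i)" using block_index_bounds(2)[OF \<nu>(1,2), of j] by simp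
    qed
    then have "blinfun_apply (xs j) (x i) = (if j = i then 1 else 0)
        + blinfun_apply (\<phi> (b i)) (e i) * (if b j < b i then a j else 0)
        - a j * (blinfun_apply (\<phi> (Suc (b j))) (e i) + blinfun_apply (\<phi> (b i)) (e i) * (if Suc (b j) < b i then 1 else 0))"
      by (simp add: xs_def x_def \<psi>_def es_u blinfun.add_left blinfun.add_right blinfun.minus_left
          blinfun.diff_left
          blinfun.scaleR_left blinfun.scaleR_right coord coord_s \<phi>_w algebra_simps)
    also have "\<dots> = (if j = i then 1 else 0)"
      by (subst \<phi>_e[of "Suc (b j)" i]) auto
    finally show "blinfun_apply (xs j) (x i) = (if j = i then 1 else 0)" .
  qed
  have schauder: "schauder_basis x"
    unfolding x_def
  proof (rule block_perturbation_basis[where \<psi> = \<psi>])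
    show "biorthogonal_functionals (\<lambda>i. e i + blinfun_apply (\<phi> (b i)) (e i) *\<^sub>R s (\<nu> (b i)))
     (\<lambda>j. es j + blinfun_apply (es j) (u (b j)) *\<^sub>R \<psi> (b j))"
      using biorth by (simp add: x_def xs_def)
    show "norm (s (\<nu> k)) \<le> L" for k by (rule norm_s)
    show "(\<lambda>l. blinfun_apply (\<psi> l) y) \<longlonglongrightarrow> 0" for y
      unfolding \<psi>_def using tendsto_minus[OF filterlim_compose[OF \<phi>_tendsto filterlim_Suc]]
      by (simp add: blinfun.minus_left)
    fix y
    \<comment> \<open>The sum telescopes because
      \<open>u n + s (\<nu> n) = s (\<nu> (Suc n))\<close>.\<close>
    have "(\<Sum>l<n. blinfun_apply (\<psi> l) y *\<^sub>R u l + (blinfun_apply (\<phi> l) y + blinfun_apply (\<psi> l) y) *\<^sub>R s (\<nu> l))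
       = - (blinfun_apply (\<phi> n) y *\<^sub>R s (\<nu> n))" for n
    proof (induction n)
      case 0
      then show ?case by (simp add: \<nu> s_def)
    next
      case (Suc n)
      have "s (\<nu> (Suc n)) = s (\<nu> n) + u n" by (simp add: u_def)
      then show ?case unfolding sum.lessThan_Suc Suc.IH by (simp add: \<psi>_def blinfun.minus_left algebra_simps)
    qed
    moreover have "(\<lambda>n. - (blinfun_apply (\<phi> n) y *\<^sub>R s (\<nu> n))) \<longlonglongrightarrow> 0"
    proof (rule Lim_null_comparison[OF always_eventually], rule allI)
      show "norm (- (blinfun_apply (\<phi> n) y *\<^sub>R s (\<nu> n))) \<le> \<bar>blinfun_apply (\<phi> n) y\<bar> * L" for n
        using norm_s[of "\<nu> n"] by (simp add: mult_left_mono)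
      show "(\<lambda>n. \<bar>blinfun_apply (\<phi> n) y\<bar> * L) \<longlonglongrightarrow> 0"
        by (intro tendsto_mult_left_zero tendsto_rabs_zero \<phi>_tendsto)
    qed
    ultimately show "(\<lambda>n. \<Sum>l<n. blinfun_apply (\<psi> l) y *\<^sub>R u l
      + (blinfun_apply (\<phi> l) y + blinfun_apply (\<psi> l) y) *\<^sub>R s (\<nu> l)) \<longlonglongrightarrow> 0" by simp
  qed
  \<comment> \<open>The one-point index type serves to match
    \<open>closed_subspace_null_functionals\<close>.\<close>
  define M where "M = {g :: 'a \<Rightarrow>\<^sub>L real. \<forall>k::unit. (\<lambda>n. blinfun_apply g (s n)) \<longlonglongrightarrow> 0}"
  have M: "subspace M" "closed M"
    unfolding M_def using norm_s by (rule closed_subspace_null_functionals)+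
  have "(\<lambda>n. blinfun_apply (xs j) (s n)) \<longlonglongrightarrow> 0" for j
  proof (rule tendsto_eventually, rule eventually_sequentiallyI)
    fix n assume n: "max (Suc j) (\<nu> (Suc (Suc (b j)))) \<le> n"
    then show "blinfun_apply (xs j) (s n) = 0"
      by (simp add: xs_def es_u blinfun.add_left blinfun.diff_left blinfun.scaleR_left blinfun.minus_left \<psi>_def coord_s \<phi>_s)
  qed
  then have "xs j \<in> M" for j by (simp add: M_def)
  with schauder biorth have "basic_subspace M" unfolding basic_subspace_def by blast
  moreover have "\<not> unconditionally_basic_subspace M"
  proof
    assume "unconditionally_basic_subspace M"
    then obtain z f where z: "unconditional_basis z" "biorthogonal_functionals z f" and fM: "\<And>i. f i \<in> M"
      unfolding unconditionally_basic_subspace_def by blast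
    then obtain K' where "unconditional_system z f K'" using unconditional_basis_system by blast
    then interpret Z: unconditional_system z f K' .
    define g where "g = \<phi> 0"
    \<comment> \<open>Summing over \<open>k\<close> first gives 0 because \<open>f i\<close> lies in
      \<open>M\<close>; summing over \<open>i\<close> first gives the values of \<open>g\<close> at
      \<open>a k *\<^sub>R e k\<close>, with total 1.\<close>
    have "(1::real) = 0"
    proof (rule double_sum_limit)
      show "\<bar>\<Sum>k\<in>A. \<Sum>i\<in>B. blinfun_apply g (z i) * blinfun_apply (f i) (a k *\<^sub>R e k)\<bar> \<le> norm g * (K' * (K * L))"
        if A: "finite A" and B: "finite B" for A B
      proof -
        define v where "v = (\<Sum>k\<in>A. a k *\<^sub>R e k)"
        obtain n where n: "A \<subseteq> {..<n}" using finite_nat_iff_bounded A by blast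
        have "v = proj A (s n)" unfolding v_def proj_def coord_s using n by (intro sum.cong) auto
        then have v: "norm v \<le> K * L"
          using order_trans[OF norm_proj[OF A, of "s n"] mult_left_mono[OF norm_s]] K_ge_1 by simp
        have "(\<Sum>k\<in>A. \<Sum>i\<in>B. blinfun_apply g (z i) * blinfun_apply (f i) (a k *\<^sub>R e k))
          = blinfun_apply g (Z.proj B v)"
          unfolding Z.apply_proj v_def blinfun.sum_right sum_distrib_left by (rule sum.swap)
        also have "\<bar>\<dots>\<bar> \<le> norm g * norm (Z.proj B v)" using norm_blinfun[of g] by simp
        also have "\<dots> \<le> norm g * (K' * (K * L))"
          using order_trans[OF Z.norm_proj[OF B, of v] mult_left_mono[OF v]] Z.K_ge_1
          by (intro mult_left_mono) auto
        finally show ?thesis .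
      qed
      show "(\<lambda>k. blinfun_apply g (z i) * blinfun_apply (f i) (a k *\<^sub>R e k)) sums 0" for i
      proof -
        have "(\<lambda>n. blinfun_apply (f i) (s n)) \<longlonglongrightarrow> 0" using fM[of i] by (simp add: M_def)
        then have "(\<lambda>k. blinfun_apply (f i) (a k *\<^sub>R e k)) sums 0"
          by (simp add: sums_def s_def blinfun.sum_right)
        then show ?thesis using sums_mult[of _ 0 "blinfun_apply g (z i)"] by simp
      qed
      show "(\<lambda>i. blinfun_apply g (z i) * blinfun_apply (f i) (a k *\<^sub>R e k)) sums blinfun_apply g (a k *\<^sub>R e k)" for k
        by (rule Z.functional_sums)
      have "(\<lambda>n. blinfun_apply g (s n)) \<longlonglongrightarrow> 1"
        by (rule tendsto_eventually, rule eventually_sequentiallyI[of "\<nu> (Suc 0)"]) (simp add: g_def \<phi>_s)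
      then show "(\<lambda>k. blinfun_apply g (a k *\<^sub>R e k)) sums 1"
        by (simp add: sums_def s_def blinfun.sum_right)
    qed
    then show False by simp
  qed
  ultimately show ?thesis using M by blast
qed

end

section \<open>Bases that are not shrinking\<close>

text \<open>The tree of finite sequences of natural numbers, coded on the natural numbers with root 0;
  \<open>parent 0\<close> is a junk value.\<close>

definition parent :: "nat \<Rightarrow> nat" where
  "parent k = fst (prod_decode (k - 1))"

definition child :: "nat \<Rightarrow> nat \<Rightarrow> nat" where
  "child k n = Suc (prod_encode (k, n))"

lemma parent_child [simp]: "parent (child k n) = k"
  by (simp add: parent_def child_def)

lemma parent_less: "0 < k \<Longrightarrow> parent k < k"
  using le_prod_encode_1[of "parent k" "snd (prod_decode (k - 1))"] by (simp add: parent_def)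

lemma child_greater: "n < child k n"
  using le_prod_encode_2[of n k] by (simp add: child_def)

function anc :: "nat \<Rightarrow> nat set" where
  "anc k = (if k = 0 then {} else insert (parent k) (anc (parent k)))"
  by pat_completeness auto
termination by (relation "Wellfounded.measure id") (auto simp: parent_less)

function depth :: "nat \<Rightarrow> nat" where
  "depth k = (if k = 0 then 0 else Suc (depth (parent k)))"
  by pat_completeness auto
termination by (relation "Wellfounded.measure id") (auto simp: parent_less)

declare anc.simps [simp del] depth.simps [simp del]

lemma anc_0 [simp]: "anc 0 = {}"
  and depth_0 [simp]: "depth 0 = 0"
  and depth_child [simp]: "depth (child k n) = Suc (depth k)"
  and anc_child [simp]: "anc (child k n) = insert k (anc k)"
  by (simp_all add: anc.simps[of 0] depth.simps[of 0] anc.simps[of "child k n"] depth.simps[of "child k n"])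
    (simp_all add: child_def)

lemma anc_pos: "0 < k \<Longrightarrow> anc k = insert (parent k) (anc (parent k))"
  by (simp add: anc.simps[of k])

lemma anc_less: "l \<in> anc k \<Longrightarrow> l < k"
proof (induction k rule: less_induct)
  case (less k)
  show ?case
  proof (cases "k = 0")
    case False
    then show ?thesis
      using less.prems less.IH[of "parent k"] parent_less[of k] by (force simp: anc_pos)
  qed (use less.prems in simp)
qed

section \<open>Absolute summability over blocks and telescoping along branches\<close>

context block_system
begin

lemma lessThan_blocks: "(\<Sum>i<\<nu> n. h i) = (\<Sum>k<n. \<Sum>i\<in>I k. (h i :: real))"
proof (induction n)
  case (Suc n)
  have "(\<Sum>i<\<nu> (Suc n). h i) = (\<Sum>i<\<nu> n. h i) + (\<Sum>i\<in>I n. h i)"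
    unfolding lessThan_\<nu>_Suc by (rule sum.union_disjoint) auto
  then show ?case by (simp add: Suc.IH)
qed (simp add: \<nu>_0)

text \<open>With one \<open>f\<close> for all blocks, the \<open>\<phi> k\<close> are restrictions
  of \<open>f\<close> to disjoint sets of coordinates, so \<open>sum_abs_le\<close> controls them
  together.\<close>

lemma sum_abs_\<phi>_le:
  assumes "\<And>k. \<gamma> k = f"
  shows "(\<Sum>k<n. \<bar>blinfun_apply (\<phi> k) y\<bar>) \<le> 2 * K * norm f * norm y"
proof -
  have "(\<Sum>k<n. \<bar>blinfun_apply (\<phi> k) y\<bar>) \<le> (\<Sum>k<n. \<Sum>i\<in>I k. \<bar>blinfun_apply f (e i) * blinfun_apply (es i) y\<bar>)"
    by (rule sum_mono) (unfold \<phi>_apply assms apply_proj, rule sum_abs)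
  also have "\<dots> \<le> 2 * K * norm f * norm y"
    unfolding lessThan_blocks[symmetric] by (rule sum_abs_le) simp
  finally show ?thesis .
qed

text \<open>\<open>B n k\<close> is the coefficient of \<open>\<phi> k\<close> in the sum \<open>full_blocks\<close>. It telescopes along the branch from
  the root to \<open>k\<close>, leaving only the vector of the last ancestor below \<open>n\<close>.\<close>

lemma tree_vectors:
  defines "w \<equiv> \<lambda>k. if k = 0 then 0 else - u (parent k)"
  defines "B \<equiv> \<lambda>n k. \<Sum>l<n. (if l \<in> anc k then u l else 0) + ((if l = k then w l else 0) + (if l \<in> anc k then w l else 0))"
  shows "k < n \<Longrightarrow> B n k = 0" "norm (B n k) \<le> D"
proof -
  have B0: "B n 0 = 0" for n
  proof -
    have "(if l \<in> anc 0 then u l else 0) + ((if l = 0 then w l else 0) + (if l \<in> anc 0 then w l else 0)) = 0" for l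
      by (simp add: w_def)
    then show ?thesis unfolding B_def by (simp only: sum.neutral_const)
  qed
  \<comment> \<open>The ancestors of \<open>k\<close> are its parent and the ancestors of the
    parent. \<open>w (parent k)\<close> is subtracted because \<open>B n (parent k)\<close> already
    contains it; once \<open>k < n\<close>, \<open>w k\<close> cancels
    \<open>u (parent k)\<close>.\<close>
  have step: "B n k = (if parent k < n then u (parent k) + w (parent k) else 0) + (if k < n then w k else 0)
      + (B n (parent k) - (if parent k < n then w (parent k) else 0))" if k: "0 < k" for n k
  proof -
    let ?p = "parent k"
    have p: "?p \<notin> anc ?p" using anc_less by blast
    have "B n k = (\<Sum>l<n. (if l = ?p then u l else 0) + (if l = ?p then w l else 0) + (if l = k then w l else 0)
       + ((if l \<in> anc ?p then u l else 0) + ((if l = ?p then w l else 0) + (if l \<in> anc ?p then w l else 0))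
        - (if l = ?p then w l else 0)))"
      unfolding B_def by (rule sum.cong) (use k p in \<open>auto simp: anc_pos\<close>)
    also have "\<dots> = (\<Sum>l<n. if l = ?p then u l else 0) + (\<Sum>l<n. if l = ?p then w l else 0)
       + (\<Sum>l<n. if l = k then w l else 0) + (B n ?p - (\<Sum>l<n. if l = ?p then w l else 0))"
      unfolding B_def sum.distrib sum_subtractf by simp
    finally show ?thesis by simp
  qed
  have wk: "w k = - u (parent k)" if "0 < k" for k using that by (simp add: w_def)
  have small: "B n k = 0" if "k < n" for k n
    using that
  proof (induction k rule: less_induct)
    case (less k)
    show ?case
    proof (cases "k = 0")
      case False
      then have "parent k < k" by (simp add: parent_less)
      with less False show ?thesis using step[of k n] by (simp add: wk)
    qed (simp add: B0)
  qed
  then show "k < n \<Longrightarrow> B n k = 0" .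
  show "norm (B n k) \<le> D"
  proof (induction k rule: less_induct)
    case (less k)
    consider "k < n \<or> k = 0" | "k \<ge> n" "0 < k" "parent k < n" | "k \<ge> n" "0 < k" "parent k \<ge> n" by linarith
    then show ?case
    proof cases
      case 1
      then show ?thesis using small B0 D_nonneg by fastforce
    next
      \<comment> \<open>The one place on the branch where the cancellation fails:
        \<open>u (parent k)\<close> is counted but \<open>w k\<close> is not.\<close>
      case 2
      then show ?thesis using step[of k n] small[of "parent k" n] norm_u[of "parent k"] by simp
    next
      case 3
      then show ?thesis using step[of k n] less[OF parent_less] by simp
    qed
  qed
qed

end

section \<open>Functionals whose value at a node is the limit over its children\<close>

context unconditional_system
begin

text \<open>The hypothesis says that \<open>f\<close> does not decay along the coordinates. Sending
  \<open>e i\<close> to \<open>x i\<close> turns \<open>u k\<close> into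
  \<open>u k - u (parent k)\<close> and fixes \<open>u 0\<close>; on the vectors \<open>u m\<close>,
  \<open>xs j\<close> is a multiple of the indicator of the subtree rooted at
  \<open>b j\<close>.\<close>

lemma not_shrinking_case:
  fixes f :: "'a \<Rightarrow>\<^sub>L real"
  assumes blocks: "\<And>N. \<exists>m>N. \<exists>v. proj {N..<m} v = v \<and> blinfun_apply f v = 1 \<and> norm v \<le> D"
  shows "\<exists>M. subspace M \<and> closed M \<and> basic_subspace M \<and> \<not> unconditionally_basic_subspace (M :: ('a \<Rightarrow>\<^sub>L real) set)"
proof -
  obtain \<nu> where \<nu>: "strict_mono \<nu>" "\<nu> 0 = 0"
    "\<And>k. \<exists>v. proj {\<nu> k..<\<nu> (Suc k)} v = v \<and> blinfun_apply f v = 1 \<and> norm v \<le> D"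
    using ex_block_sequence[OF blocks] by blast
  then obtain u where u: "\<And>k. proj {\<nu> k..<\<nu> (Suc k)} (u k) = u k" "\<And>k. blinfun_apply f (u k) = 1"
    "\<And>k. norm (u k) \<le> D" by metis
  interpret block_system e es K \<nu> u "\<lambda>_. f" "norm f" D
    by unfold_locales (use \<nu> u in auto)
  have wuc: "(\<Sum>k<n. \<bar>blinfun_apply (\<phi> k) y\<bar>) \<le> 2 * K * norm f * norm y" for n y
    by (rule sum_abs_\<phi>_le) simp
  \<comment> \<open>\<open>\<psi> l\<close> is the pointwise sum of \<open>\<phi> k\<close> over the
    proper descendants \<open>k\<close> of \<open>l\<close>.\<close>
  have "\<exists>\<psi>. \<forall>l y. (\<lambda>k. if k \<in> {k. l \<in> anc k} then blinfun_apply (\<phi> k) y else 0) sums blinfun_apply (\<psi> l) y"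
    using wuc_functional[OF wuc] by (intro choice) blast
  then obtain \<psi> where \<psi>: "\<And>l y. (\<lambda>k. if l \<in> anc k then blinfun_apply (\<phi> k) y else 0) sums blinfun_apply (\<psi> l) y"
    by auto
  have \<psi>_single: "blinfun_apply (\<psi> l) y = (if l \<in> anc m then blinfun_apply (\<phi> m) y else 0)"
    if "\<And>k. k \<noteq> m \<Longrightarrow> blinfun_apply (\<phi> k) y = 0" for l m y
  proof (rule sums_unique2[OF \<psi>])
    have "(\<lambda>k. if l \<in> anc k then blinfun_apply (\<phi> k) y else 0)
       = (\<lambda>k. if k = m then (if l \<in> anc k then blinfun_apply (\<phi> k) y else 0) else 0)"
      using that by auto
    then show "(\<lambda>k. if l \<in> anc k then blinfun_apply (\<phi> k) y else 0) sums (if l \<in> anc m then blinfun_apply (\<phi> m) y else 0)"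
      using sums_single[of m "\<lambda>k. if l \<in> anc k then blinfun_apply (\<phi> k) y else 0"] by (simp only:)
  qed
  have \<psi>_e: "blinfun_apply (\<psi> l) (e i) = (if l \<in> anc (b i) then blinfun_apply (\<phi> (b i)) (e i) else 0)" for l i
    by (rule \<psi>_single) (subst \<phi>_e, simp)
  have \<psi>_u: "blinfun_apply (\<psi> l) (u k) = (if l \<in> anc k then 1 else 0)" for l k
    using \<psi>_single[of k "u k" l] by (simp add: \<phi>_u)
  define w where "w k = (if k = 0 then 0 else - u (parent k))" for k
  define x where "x = (\<lambda>i. e i + blinfun_apply (\<phi> (b i)) (e i) *\<^sub>R w (b i))"
  define xs where "xs = (\<lambda>j. es j + blinfun_apply (es j) (u (b j)) *\<^sub>R \<psi> (b j))"
  have biorth: "biorthogonal_functionals x xs"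
    unfolding biorthogonal_functionals_def
  proof (intro allI)
    fix j i
    show "blinfun_apply (xs j) (x i) = (if j = i then 1 else 0)"
    proof (cases "b i = 0")
      case True
      then show ?thesis
        by (simp add: x_def xs_def w_def blinfun.add_left blinfun.scaleR_left coord \<psi>_e)
    next
      case False
      define p F G where "p = parent (b i)" and "F = blinfun_apply (\<phi> (b i)) (e i)"
        and "G = blinfun_apply (es j) (u (b j))"
      have E: "blinfun_apply (es j) (u p) = (if b j = p then G else 0)"
        unfolding G_def by (subst coord_u) auto
      have an: "b j \<in> anc (b i) \<longleftrightarrow> b j = p \<or> b j \<in> anc p"
        using False by (simp add: anc_pos p_def)
      have pp: "p \<notin> anc p" using anc_less by blast
      have "x i = e i - F *\<^sub>R u p" using False by (simp add: x_def w_def p_def F_def)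
      then have "blinfun_apply (xs j) (x i) = (blinfun_apply (es j) (e i) - F * blinfun_apply (es j) (u p))
          + G * (blinfun_apply (\<psi> (b j)) (e i) - F * blinfun_apply (\<psi> (b j)) (u p))"
        by (simp add: xs_def G_def blinfun.add_left blinfun.diff_right blinfun.scaleR_left blinfun.scaleR_right
            right_diff_distrib distrib_left)
      also have "\<dots> = (if j = i then 1 else 0) - F * (if b j = p then G else 0)
          + G * ((if b j = p \<or> b j \<in> anc p then F else 0) - F * (if b j \<in> anc p then 1 else 0))"
        unfolding coord E \<psi>_e \<psi>_u an F_def[symmetric] ..
      \<comment> \<open>If \<open>b j = p\<close>, the contribution of \<open>es j\<close> cancels
        that of \<open>\<psi> (b j)\<close> at \<open>e i\<close>; if \<open>b j\<close> is an
        ancestor of \<open>p\<close>, the two values of \<open>\<psi> (b j)\<close> cancel. By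
        \<open>pp\<close> these cases exclude each other.\<close>
      also have "\<dots> = (if j = i then 1 else 0)" using pp by auto
      finally show ?thesis .
    qed
  qed
  \<comment> \<open>Descendants of \<open>l\<close> have codes above \<open>l\<close>, so this
    remainder dominates \<open>\<psi> l y\<close>; multiplied by \<open>D\<close> it also dominates
    the sums \<open>?T n\<close>.\<close>
  define tail where "tail y n = (\<Sum>k. \<bar>blinfun_apply (\<phi> k) y\<bar>) - (\<Sum>k<n. \<bar>blinfun_apply (\<phi> k) y\<bar>)" for y n
  have abs: "summable (\<lambda>k. \<bar>blinfun_apply (\<phi> k) y\<bar>)" for y
    by (rule bounded_imp_summable[of _ "2 * K * norm f * norm y"])
      (use wuc[where y = y] in \<open>simp_all add: lessThan_Suc_atMost[symmetric] del: sum.lessThan_Suc\<close>)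
  have tail: "(\<lambda>k. if k < n then 0 else \<bar>blinfun_apply (\<phi> k) y\<bar>) sums tail y n" for y n
  proof -
    have "(\<lambda>k. if k \<in> {..<n} then \<bar>blinfun_apply (\<phi> k) y\<bar> else 0) sums (\<Sum>k<n. \<bar>blinfun_apply (\<phi> k) y\<bar>)"
      by (rule sums_If_finite_set) simp
    from sums_diff[OF summable_sums[OF abs[of y]] this] show ?thesis
      unfolding tail_def by (rule back_subst[of "\<lambda>t. t sums _"]) auto
  qed
  have tail_lim: "tail y \<longlonglongrightarrow> 0" for y
    using tendsto_diff[OF tendsto_const[of "suminf (\<lambda>k. \<bar>blinfun_apply (\<phi> k) y\<bar>)"] summable_LIMSEQ[OF abs[of y]]]
    unfolding tail_def by simp
  have schauder: "schauder_basis x"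
    unfolding x_def
  proof (rule block_perturbation_basis[where \<psi> = \<psi>])
    show "biorthogonal_functionals (\<lambda>i. e i + blinfun_apply (\<phi> (b i)) (e i) *\<^sub>R w (b i))
     (\<lambda>j. es j + blinfun_apply (es j) (u (b j)) *\<^sub>R \<psi> (b j))"
      using biorth by (simp add: x_def xs_def)
    show "norm (w k) \<le> D" for k using D_nonneg u(3) by (simp add: w_def)
    show "(\<lambda>l. blinfun_apply (\<psi> l) y) \<longlonglongrightarrow> 0" for y
    proof (rule Lim_null_comparison[OF always_eventually tail_lim[of y]], rule allI)
      fix l
      have le: "norm (if l \<in> anc k then blinfun_apply (\<phi> k) y else 0) \<le> (if k < l then 0 else \<bar>blinfun_apply (\<phi> k) y\<bar>)" for k
        using anc_less[of l k] by auto
      then have sm: "summable (\<lambda>k. norm (if l \<in> anc k then blinfun_apply (\<phi> k) y else 0))"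
        by (intro summable_comparison_test'[OF sums_summable[OF tail[of l y]]]) simp
      have "norm (blinfun_apply (\<psi> l) y) \<le> (\<Sum>k. norm (if l \<in> anc k then blinfun_apply (\<phi> k) y else 0))"
        using summable_norm[OF sm] \<psi>[of l y] by (simp add: sums_iff)
      also have "\<dots> \<le> tail y l"
        using suminf_le[OF le sm sums_summable[OF tail]] tail[of l y] by (simp add: sums_iff)
      finally show "norm (blinfun_apply (\<psi> l) y) \<le> tail y l" .
    qed
    fix y
    let ?T = "\<lambda>n. \<Sum>l<n. blinfun_apply (\<psi> l) y *\<^sub>R u l + (blinfun_apply (\<phi> l) y + blinfun_apply (\<psi> l) y) *\<^sub>R w l"
    show "?T \<longlonglongrightarrow> 0"
    proof (rule Lim_null_comparison[OF always_eventually], rule allI)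
      fix n
      define B where "B k = (\<Sum>l<n. (if l \<in> anc k then u l else 0)
        + ((if l = k then w l else 0) + (if l \<in> anc k then w l else 0)))" for k
      have B: "k < n \<Longrightarrow> B k = 0" "norm (B k) \<le> D" for k
        unfolding B_def w_def by (rule tree_vectors, assumption) (rule tree_vectors)
      \<comment> \<open>Each functional value at \<open>y\<close> is written as its series over
        \<open>k\<close>, so that \<open>B k\<close> appears as the coefficient of
        \<open>\<phi> k\<close>.\<close>
      have "(\<lambda>k. \<Sum>l<n. (if l \<in> anc k then blinfun_apply (\<phi> k) y else 0) *\<^sub>R u l
         + ((if k = l then blinfun_apply (\<phi> k) y else 0) + (if l \<in> anc k then blinfun_apply (\<phi> k) y else 0)) *\<^sub>R w l) sums ?T n"
        by (intro sums_sum sums_add sums_scaleR_left \<psi> sums_single)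
      moreover have "(\<Sum>l<n. (if l \<in> anc k then blinfun_apply (\<phi> k) y else 0) *\<^sub>R u l
         + ((if k = l then blinfun_apply (\<phi> k) y else 0) + (if l \<in> anc k then blinfun_apply (\<phi> k) y else 0)) *\<^sub>R w l)
         = blinfun_apply (\<phi> k) y *\<^sub>R B k" for k
        unfolding B_def scaleR_sum_right by (rule sum.cong) (auto simp: algebra_simps)
      ultimately have T: "(\<lambda>k. blinfun_apply (\<phi> k) y *\<^sub>R B k) sums ?T n" by simp
      have le: "norm (blinfun_apply (\<phi> k) y *\<^sub>R B k) \<le> (if k < n then 0 else \<bar>blinfun_apply (\<phi> k) y\<bar>) * D" for k
        using B[of k] by (simp add: mult_left_mono)
      note tD = sums_mult2[OF tail[of n y], of D]
      have sm: "summable (\<lambda>k. norm (blinfun_apply (\<phi> k) y *\<^sub>R B k))"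
        by (rule summable_comparison_test'[OF sums_summable[OF tD]]) (use le in simp)
      have "norm (?T n) \<le> (\<Sum>k. norm (blinfun_apply (\<phi> k) y *\<^sub>R B k))"
        using summable_norm[OF sm] T by (simp add: sums_iff)
      also have "\<dots> \<le> tail y n * D"
        using suminf_le[OF le sm sums_summable[OF tD]] tD by (simp add: sums_iff)
      finally show "norm (?T n) \<le> tail y n * D" .
    next
      show "(\<lambda>n. tail y n * D) \<longlonglongrightarrow> 0" by (intro tendsto_mult_left_zero tail_lim)
    qed
  qed
  define M where "M = {g :: 'a \<Rightarrow>\<^sub>L real. \<forall>k. (\<lambda>n. blinfun_apply g (u (child k n) - u k)) \<longlonglongrightarrow> 0}"
  have "norm (u (child k n) - u k) \<le> D + D" for k n
    using norm_triangle_ineq4[of "u (child k n)" "u k"] u(3)[of "child k n"] u(3)[of k] by linarith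
  then have M: "subspace M" "closed M"
    unfolding M_def by (rule closed_subspace_null_functionals)+
  have "(\<lambda>n. blinfun_apply (xs j) (u (child k n) - u k)) \<longlonglongrightarrow> 0" for j k
  proof (rule tendsto_eventually, rule eventually_sequentiallyI)
    \<comment> \<open>The code of a child exceeds its number, so for large \<open>n\<close> the
      child is not \<open>b j\<close> itself; it then lies below \<open>b j\<close> exactly when
      \<open>k\<close> is \<open>b j\<close> or lies below it.\<close>
    fix n assume "b j \<le> n"
    then have ne: "b j \<noteq> child k n" using child_greater[of n k] by simp
    have val: "blinfun_apply (xs j) (u m) = blinfun_apply (es j) (u (b j)) * (if b j = m \<or> b j \<in> anc m then 1 else 0)" for m
      using coord_u[of j m] anc_less[of "b j" m]
      by (auto simp: xs_def blinfun.add_left blinfun.scaleR_left \<psi>_u)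
    show "blinfun_apply (xs j) (u (child k n) - u k) = 0"
      using ne by (simp add: blinfun.diff_right val)
  qed
  then have "xs j \<in> M" for j by (simp add: M_def)
  with schauder biorth have "basic_subspace M" unfolding basic_subspace_def by blast
  moreover have "\<not> unconditionally_basic_subspace M"
  proof
    assume "unconditionally_basic_subspace M"
    then obtain z h where z: "unconditional_basis z" "biorthogonal_functionals z h" and hM: "\<And>i. h i \<in> M"
      unfolding unconditionally_basic_subspace_def by blast
    then obtain K' where "unconditional_system z h K'" using unconditional_basis_system by blast
    then interpret Z: unconditional_system z h K' .
    obtain g where g: "\<And>y. (\<lambda>k. if k \<in> {k. even (depth k)} then blinfun_apply (\<phi> k) y else 0) sums blinfun_apply g y"
      using wuc_functional[OF wuc] by blast
    have g_u: "blinfun_apply g (u k) = (if even (depth k) then 1 else 0)" for k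
    proof (rule sums_unique2[OF g])
      have "(\<lambda>m. if m \<in> {m. even (depth m)} then blinfun_apply (\<phi> m) (u k) else 0)
        = (\<lambda>m. if m = k then (if even (depth m) then 1 else 0) else 0)"
        by (auto simp: \<phi>_u)
      then show "(\<lambda>m. if m \<in> {m. even (depth m)} then blinfun_apply (\<phi> m) (u k) else 0)
         sums (if even (depth k) then 1 else 0)"
        using sums_single[of k "\<lambda>m. if even (depth m) then 1 else (0::real)"] by (simp only:)
    qed
    define t where "t i k = blinfun_apply g (z i) * blinfun_apply (h i) (u k)" for i k
    have t_bound: "(\<Sum>i<m. \<bar>t i k\<bar>) \<le> 2 * K' * norm g * D" for m k
      unfolding t_def
      by (rule order_trans[OF Z.sum_abs_le mult_left_mono]) (use u(3) Z.K_ge_1 in auto)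
    have t_sums: "(\<lambda>m. \<Sum>i<m. t i k) \<longlonglongrightarrow> (if even (depth k) then 1 else 0)" for k
      using Z.functional_sums[of g "u k"] by (simp add: t_def sums_def g_u)
    have t_child: "(\<lambda>n. t i (child k n)) \<longlonglongrightarrow> t i k" for i k
    proof -
      have "(\<lambda>n. blinfun_apply (h i) (u (child k n)) - blinfun_apply (h i) (u k)) \<longlonglongrightarrow> 0"
        using hM[of i] by (simp add: M_def blinfun.diff_right)
      then show ?thesis unfolding t_def by (intro tendsto_mult tendsto_const) (rule LIM_zero_cancel)
    qed
    \<comment> \<open>Passing to a suitable child adds more than 1/2 to the variation: the first
      \<open>m\<close> terms are still near the old parity value while the full sum takes the
      opposite one. The offset \<open>- 1\<close> makes the strict base case trivial.\<close>
    have variation: "\<exists>k m. (even (depth k) \<longleftrightarrow> even N) \<and> \<bar>(\<Sum>i<m. t i k) - (if even N then 1 else 0)\<bar> < 1/4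
        \<and> (\<Sum>i<m. \<bar>t i k\<bar>) > real N / 2 - 1" for N
    proof (induction N)
      case 0
      obtain m where "\<bar>(\<Sum>i<m. t i 0) - 1\<bar> < 1/4"
        using LIMSEQ_D[OF t_sums[of 0], of "1/4"] by auto
      moreover have "real 0 / 2 - 1 < (\<Sum>i<m. \<bar>t i 0\<bar>)"
        by (rule less_le_trans[OF _ sum_nonneg]) simp_all
      ultimately show ?case
        by (intro exI[of _ 0] exI[of _ m] conjI) (simp_all only: depth_0 even_zero if_True)
    next
      case (Suc N)
      then obtain k m where km: "even (depth k) \<longleftrightarrow> even N"
        "\<bar>(\<Sum>i<m. t i k) - (if even N then 1 else 0)\<bar> < 1/4" "(\<Sum>i<m. \<bar>t i k\<bar>) > real N / 2 - 1"
        by blast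
      have 1: "(\<lambda>n. \<bar>(\<Sum>i<m. t i (child k n)) - (if even N then 1 else 0)\<bar>)
          \<longlonglongrightarrow> \<bar>(\<Sum>i<m. t i k) - (if even N then 1 else 0)\<bar>"
        by (intro tendsto_intros t_child)
      have 2: "(\<lambda>n. \<Sum>i<m. \<bar>t i (child k n)\<bar>) \<longlonglongrightarrow> (\<Sum>i<m. \<bar>t i k\<bar>)"
        by (intro tendsto_intros t_child)
      \<comment> \<open>Only finitely many terms are involved, so both strict estimates persist at
        some child.\<close>
      obtain n where n: "\<bar>(\<Sum>i<m. t i (child k n)) - (if even N then 1 else 0)\<bar> < 1/4"
        "(\<Sum>i<m. \<bar>t i (child k n)\<bar>) > real N / 2 - 1"
        using eventually_happens'[OF sequentially_bot
            eventually_conj[OF order_tendstoD(2)[OF 1 km(2)] order_tendstoD(1)[OF 2 km(3)]]] by blast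
      define c where "c = child k n"
      have dc: "even (depth c) \<longleftrightarrow> even (Suc N)" using km(1) by (simp add: c_def)
      obtain m0 where m0: "\<And>m'. m' \<ge> m0 \<Longrightarrow> \<bar>(\<Sum>i<m'. t i c) - (if even (Suc N) then 1 else 0)\<bar> < 1/4"
        using LIMSEQ_D[OF t_sums[of c], of "1/4"] dc by auto
      define m' where "m' = max m m0"
      have m': "\<bar>(\<Sum>i<m'. t i c) - (if even (Suc N) then 1 else 0)\<bar> < 1/4" and mm': "m \<le> m'"
        using m0[of m'] by (simp_all add: m'_def)
      have split: "(\<Sum>i<m'. p i) = (\<Sum>i<m. p i) + (\<Sum>i=m..<m'. p i)" for p :: "nat \<Rightarrow> real"
        using sum.atLeastLessThan_concat[of 0 m m' p] mm' by (simp add: lessThan_atLeast0)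
      have "\<bar>\<Sum>i=m..<m'. t i c\<bar> > 1/2"
      proof (cases "even N")
        case True
        then have "\<bar>(\<Sum>i<m. t i c) - 1\<bar> < 1/4" "\<bar>\<Sum>i<m'. t i c\<bar> < 1/4"
          using n(1) m' by (simp_all add: c_def)
        then show ?thesis using split[of "\<lambda>i. t i c"] by linarith
      next
        case False
        then have "\<bar>\<Sum>i<m. t i c\<bar> < 1/4" "\<bar>(\<Sum>i<m'. t i c) - 1\<bar> < 1/4"
          using n(1) m' by (simp_all add: c_def)
        then show ?thesis using split[of "\<lambda>i. t i c"] by linarith
      qed
      also have "\<bar>\<Sum>i=m..<m'. t i c\<bar> \<le> (\<Sum>i=m..<m'. \<bar>t i c\<bar>)" by (rule sum_abs)
      finally have "(\<Sum>i<m'. \<bar>t i c\<bar>) > real (Suc N) / 2 - 1"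
        using n(2) split[of "\<lambda>i. \<bar>t i c\<bar>"] unfolding c_def by (simp add: add_divide_distrib)
      with dc m' show ?case by blast
    qed
    obtain N :: nat where "2 * (2 * K' * norm g * D + 1) < real N" using reals_Archimedean2 by blast
    moreover obtain k m where "(\<Sum>i<m. \<bar>t i k\<bar>) > real N / 2 - 1" using variation[of N] by blast
    ultimately show False using t_bound[of k m] by simp
  qed
  ultimately show ?thesis using M by blast
qed

end

section \<open>Reflexivity\<close>

context unconditional_system
begin

lemma proj_scaleR: "proj A (c *\<^sub>R y) = c *\<^sub>R proj A y"
  by (simp add: proj_def blinfun.scaleR_right scaleR_sum_right)

text \<open>The adjoint of \<open>proj {..<n}\<close> applied to \<open>g\<close>; its convergence
  to \<open>g\<close> for every \<open>g\<close> expresses that the basis is shrinking.\<close>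

definition dual_proj :: "nat \<Rightarrow> ('a \<Rightarrow>\<^sub>L real) \<Rightarrow> 'a \<Rightarrow>\<^sub>L real" where
  "dual_proj n g = (\<Sum>i<n. blinfun_apply g (e i) *\<^sub>R es i)"

lemma dual_proj_apply: "blinfun_apply (dual_proj n g) y = blinfun_apply g (proj {..<n} y)"
  by (simp add: dual_proj_def apply_proj blinfun.sum_left blinfun.scaleR_left)

lemma norm_dual_proj: "norm (dual_proj n g) \<le> K * norm g"
proof (rule norm_blinfun_bound)
  show "0 \<le> K * norm g" using K_ge_1 by simp
  fix y
  have "norm (blinfun_apply (dual_proj n g) y) \<le> norm g * norm (proj {..<n} y)"
    unfolding dual_proj_apply by (rule norm_blinfun)
  also have "\<dots> \<le> norm g * (K * norm y)" by (intro mult_left_mono norm_proj) auto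
  finally show "norm (blinfun_apply (dual_proj n g) y) \<le> K * norm g * norm y" by (simp add: ac_simps)
qed

text \<open>If the truncations stay at distance \<open>\<delta>\<close> from \<open>g\<close>
  infinitely often, then \<open>g\<close> exceeds \<open>\<delta> / 2 * norm y\<close> in absolute
  value on a tail of some \<open>y\<close>. Cutting that tail at a finite \<open>m\<close> and
  rescaling yields the blocks, with \<open>D = 2 * K / \<delta>\<close>.\<close>

lemma dual_proj_tendsto:
  assumes no_blocks: "\<not> (\<exists>D. \<forall>N. \<exists>m>N. \<exists>v. proj {N..<m} v = v \<and> blinfun_apply g v = 1 \<and> norm v \<le> D)"
  shows "(\<lambda>n. dual_proj n g) \<longlonglongrightarrow> g"
proof (rule ccontr)
  assume "\<not> ?thesis"
  then obtain \<delta> where \<delta>: "\<delta> > 0" "\<And>N. \<exists>n\<ge>N. norm (dual_proj n g - g) \<ge> \<delta>"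
    unfolding LIMSEQ_iff by (meson not_less)
  have "\<exists>m>N. \<exists>v. proj {N..<m} v = v \<and> blinfun_apply g v = 1 \<and> norm v \<le> 2 * K / \<delta>" for N
  proof -
    obtain n where n: "n \<ge> N" "norm (dual_proj n g - g) \<ge> \<delta>" using \<delta>(2) by blast
    have "\<exists>y. norm (blinfun_apply (dual_proj n g - g) y) > \<delta> / 2 * norm y"
    proof (rule ccontr)
      assume "\<not> ?thesis"
      then have "norm (dual_proj n g - g) \<le> \<delta> / 2"
        using \<delta>(1) by (intro norm_blinfun_bound) (auto simp: not_less)
      with n \<delta>(1) show False by simp
    qed
    then obtain y where y: "\<delta> / 2 * norm y < \<bar>blinfun_apply g (proj {..<n} y) - blinfun_apply g y\<bar>"
      by (auto simp: blinfun.diff_left dual_proj_apply)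
    have "(\<lambda>m. \<bar>blinfun_apply g (proj {..<n} y) - blinfun_apply g (proj {..<m} y)\<bar>)
        \<longlonglongrightarrow> \<bar>blinfun_apply g (proj {..<n} y) - blinfun_apply g y\<bar>"
      by (intro tendsto_intros proj_tendsto)
    from order_tendstoD(1)[OF this y]
    have "\<forall>\<^sub>F m in sequentially. n < m
        \<and> \<delta> / 2 * norm y < \<bar>blinfun_apply g (proj {..<n} y) - blinfun_apply g (proj {..<m} y)\<bar>"
      by (intro eventually_conj eventually_gt_at_top)
    then obtain m where m: "m > n"
      "\<delta> / 2 * norm y < \<bar>blinfun_apply g (proj {..<n} y) - blinfun_apply g (proj {..<m} y)\<bar>"
      using eventually_happens'[OF sequentially_bot] by blast
    define v where "v = proj {n..<m} y"
    have "{..<m} = {..<n} \<union> {n..<m}" using m(1) by auto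
    then have "proj {..<m} y = proj {..<n} y + v"
      using proj_union[of "{..<n}" "{n..<m}" y] by (force simp: v_def)
    then have gv: "\<delta> / 2 * norm y < \<bar>blinfun_apply g v\<bar>" using m(2) by (simp add: blinfun.add_right)
    then have gv0: "0 < \<bar>blinfun_apply g v\<bar>" using \<delta>(1) by (smt (verit) mult_nonneg_nonneg half_gt_zero norm_ge_zero)
    have nv: "norm v \<le> K * norm y" unfolding v_def by (rule norm_proj) simp
    \<comment> \<open>\<open>v\<close> is supported on \<open>{n..<m}\<close>; the block may start
      earlier, at \<open>N\<close>.\<close>
    have "proj {N..<m} v = v"
      unfolding v_def using n(1) by (subst proj_proj) (auto simp: Int_absorb2)
    then have "proj {N..<m} ((1 / blinfun_apply g v) *\<^sub>R v) = (1 / blinfun_apply g v) *\<^sub>R v"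
      by (simp add: proj_scaleR)
    moreover have "blinfun_apply g ((1 / blinfun_apply g v) *\<^sub>R v) = 1"
      using gv0 by (simp add: blinfun.scaleR_right)
    moreover have "norm ((1 / blinfun_apply g v) *\<^sub>R v) \<le> 2 * K / \<delta>"
    proof -
      have "norm v * \<delta> \<le> (K * norm y) * \<delta>" using nv \<delta>(1) by (intro mult_right_mono) auto
      also have "\<dots> = 2 * K * (\<delta> / 2 * norm y)" by simp
      also have "\<dots> \<le> 2 * K * \<bar>blinfun_apply g v\<bar>" using gv K_ge_1 by (intro mult_left_mono) auto
      finally show ?thesis using \<delta>(1) gv0 by (simp add: divide_simps)
    qed
    moreover have "m > N" using n(1) m(1) by simp
    ultimately show ?thesis by blast
  qed
  with no_blocks show False by blast
qed

text \<open>The sums \<open>s n\<close> with coefficients \<open>\<Phi> (es i)\<close> are bounded,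
  since \<open>g (s n)\<close> is \<open>\<Phi>\<close> of a truncation of \<open>g\<close>. Bounded
  completeness yields their limit \<open>x\<close>, and shrinking identifies \<open>\<Phi>\<close>
  with evaluation at \<open>x\<close>.\<close>

lemma reflexive_case:
  assumes boundedly_complete: "\<And>a L. (\<And>n. norm (\<Sum>i<n. a i *\<^sub>R e i) \<le> L) \<Longrightarrow> summable (\<lambda>i. a i *\<^sub>R e i)"
    and shrinking: "\<And>g. (\<lambda>n. dual_proj n g) \<longlonglongrightarrow> g"
  shows "reflexive_space TYPE('a)"
  unfolding reflexive_space_def surj_def
proof
  fix \<Phi> :: "('a \<Rightarrow>\<^sub>L real) \<Rightarrow>\<^sub>L real"
  define s where "s n = (\<Sum>i<n. blinfun_apply \<Phi> (es i) *\<^sub>R e i)" for n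
  have g_s: "blinfun_apply g (s n) = blinfun_apply \<Phi> (dual_proj n g)" for g n
    by (simp add: s_def dual_proj_def blinfun.sum_right blinfun.scaleR_right mult.commute)
  have "norm (s n) \<le> norm \<Phi> * K" for n
  proof -
    obtain g :: "'a \<Rightarrow>\<^sub>L real" where g: "norm g \<le> 1" "blinfun_apply g (s n) = norm (s n)"
      using ex_norming_functional by blast
    have "norm (s n) = blinfun_apply \<Phi> (dual_proj n g)" by (simp add: g g_s[symmetric])
    also have "\<dots> \<le> norm \<Phi> * norm (dual_proj n g)" using norm_blinfun[of \<Phi> "dual_proj n g"] by simp
    also have "\<dots> \<le> norm \<Phi> * (K * 1)"
      using K_ge_1 g(1) by (intro mult_left_mono order_trans[OF norm_dual_proj]) auto
    finally show ?thesis by simp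
  qed
  then have "summable (\<lambda>i. blinfun_apply \<Phi> (es i) *\<^sub>R e i)"
    unfolding s_def by (rule boundedly_complete)
  then obtain x where x: "s \<longlonglongrightarrow> x" unfolding s_def summable_def sums_def by blast
  have "blinfun_apply \<Phi> g = blinfun_apply g x" for g
  proof (rule LIMSEQ_unique)
    show "(\<lambda>n. blinfun_apply \<Phi> (dual_proj n g)) \<longlonglongrightarrow> blinfun_apply \<Phi> g"
      by (intro tendsto_intros shrinking)
    show "(\<lambda>n. blinfun_apply \<Phi> (dual_proj n g)) \<longlonglongrightarrow> blinfun_apply g x"
      unfolding g_s[symmetric] by (intro tendsto_intros x)
  qed
  then have "\<Phi> = canonical_embedding x" by (intro blinfun_eqI) simp
  then show "\<exists>x. \<Phi> = canonical_embedding x" by blast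
qed

end

theorem theorem1:
  assumes "\<not> reflexive_space TYPE('a::banach)"
    and "\<exists>e :: nat \<Rightarrow> 'a. unconditional_basis e"
  shows "\<exists>M :: ('a \<Rightarrow>\<^sub>L real) set. subspace M \<and> closed M \<and>
           basic_subspace M \<and> \<not> unconditionally_basic_subspace M"
proof -
  obtain e :: "nat \<Rightarrow> 'a" where e: "unconditional_basis e" using assms(2) by blast
  obtain es where "biorthogonal_functionals e es" using ex_biorthogonal_functionals[OF e] by blast
  with e obtain K where "unconditional_system e es K" using unconditional_basis_system by blast
  then interpret unconditional_system e es K .
  show ?thesis
  \<comment> \<open>When bounded completeness holds, non-reflexivity forces some \<open>g\<close>
    not to be the limit of its truncations, which supplies the blocks of the second case.\<close>
  proof (cases "\<exists>a L. (\<forall>n. norm (\<Sum>i<n. a i *\<^sub>R e i) \<le> L) \<and> \<not> summable (\<lambda>i. a i *\<^sub>R e i)")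
    case True
    then show ?thesis using not_boundedly_complete_case by blast
  next
    case False
    then have "\<not> (\<forall>g. (\<lambda>n. dual_proj n g) \<longlonglongrightarrow> g)"
      using assms(1) reflexive_case by blast
    then obtain g D where "\<forall>N. \<exists>m>N. \<exists>v. proj {N..<m} v = v \<and> blinfun_apply g v = (1::real) \<and> norm v \<le> D"
      using dual_proj_tendsto by blast
    then show ?thesis by (intro not_shrinking_case) blast
  qed
qed

end
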